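(* Let $\ell$ be a prime, let $C$ be a split or nonsplit Cartan subgroup of $\mathrm{GL}_2(\mathbb{Z}_\ell)$ and let $G=N$ be its normalizer in $\mathrm{GL}_2(\mathbb{Z}_\ell)$. Then for all $a,b\geq 0$ $$\mu_{a,b}=\tfrac12\,\mu^C_{a,b}+\tfrac12\,\mu^*_{a,b},$$ where $\mu^C_{a,b}$ is the normalized Haar measure in $C$ of $\mathcal{M}_{a,b}(N)\cap C=\mathcal{M}_{a,b}(C)$, and $$\mu^*_{a,b}=\begin{cases}\dfrac{\ell-2}{\ell-1} & a=0,\ b=0,\\[2mm] \ell^{-b} & a=0,\ b>0,\\ 0 & a>0.\end{cases}$$
   Context: Let $\ell$ be a prime. A quadratic ring over $\mathbb{Z}_\ell$ is a subring $R$ (containing $1$) of a reduced $\mathbb{Q}_\ell$-algebra $F$ of degree $2$ (so $F$ is a quadratic field extension of $\mathbb{Q}_\ell$ or $F=\mathbb{Q}_\ell^2$) such that $R$ is a finitely generated $\mathbb{Z}_\ell$-module and $\mathbb{Q}_\ell R=F$; $\mathcal{O}_F$ denotes the maximal order of $F$ ($\mathcal{O}_F=\mathbb{Z}_\ell^2$ if $F=\mathbb{Q}_\ell^2$). The Cartan subgroup of $\mathrm{GL}_2(\mathbb{Z}_\ell)$ associated with $R$ is the group $R^\times$, embedded in $\mathrm{GL}_2(\mathbb{Z}_\ell)$ via its action by left multiplication on $R$ written in a $\mathbb{Z}_\ell$-basis of $R$ (well defined up to conjugation). It is maximal if $\ell\nmid[\mathcal{O}_F:R]$; split if it is maximal and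 $F\cong\mathbb{Q}_\ell^2$; nonsplit if it is maximal and $F$ is the unramified quadratic field extension of $\mathbb{Q}_\ell$; ramified otherwise. Identify each $M\in\mathrm{GL}_2(\mathbb{Z}_\ell)$ with an automorphism of $\varinjlim_n(\mathbb{Z}/\ell^n\mathbb{Z})^2$. For a subgroup $G\subseteq\mathrm{GL}_2(\mathbb{Z}_\ell)$ and integers $a,b\geq0$ let $\mathcal{M}_{a,b}(G)=\{M\in G:\ \ker(M-I)\cong\mathbb{Z}/\ell^a\mathbb{Z}\times\mathbb{Z}/\ell^{a+b}\mathbb{Z}\}$, where the kernel is taken on $\varinjlim_n(\mathbb{Z}/\ell^n\mathbb{Z})^2$, and let $\mu_{a,b}$ be the measure of $\mathcal{M}_{a,b}(G)$ with respect to the Haar measure of $G$ normalized so that $G$ has measure $1$. *)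

theory Defs
  imports Complex_Main "HOL-Computational_Algebra.Primes" "HOL-Algebra.Elementary_Groups"
begin

text \<open>l-adic integers are represented as coherent sequences of residues:
  x n is the residue of x modulo l^n, taken in [0, l^n).\<close>

definition Zl :: "nat \<Rightarrow> (nat \<Rightarrow> int) set" where
  "Zl l = {x. \<forall>n. 0 \<le> x n \<and> x n < int l ^ n \<and> x (Suc n) mod (int l ^ n) = x n}"

text \<open>Integer 2x2 matrices (a,b,c,d) = [[a,b],[c,d]].\<close>
type_synonym imat = "int \<times> int \<times> int \<times> int"

fun mat_mod :: "int \<Rightarrow> imat \<Rightarrow> imat" where
  "mat_mod m (a,b,c,d) = (a mod m, b mod m, c mod m, d mod m)"

fun mat_mul :: "imat \<Rightarrow> imat \<Rightarrow> imat" where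
  "mat_mul (a,b,c,d) (a',b',c',d') = (a*a' + b*c', a*b' + b*d', c*a' + d*c', c*b' + d*d')"

fun mat_det :: "imat \<Rightarrow> int" where
  "mat_det (a,b,c,d) = a*d - b*c"

type_synonym lmat = "nat \<Rightarrow> imat"

definition Zl_mat :: "nat \<Rightarrow> lmat set" where
  "Zl_mat l = {M. \<forall>n. M n = mat_mod (int l ^ n) (M n) \<and> mat_mod (int l ^ n) (M (Suc n)) = M n}"

definition lmat_mul :: "nat \<Rightarrow> lmat \<Rightarrow> lmat \<Rightarrow> lmat" where
  "lmat_mul l M N = (\<lambda>n. mat_mod (int l ^ n) (mat_mul (M n) (N n)))"

definition GL2 :: "nat \<Rightarrow> lmat set" where
  "GL2 l = {M \<in> Zl_mat l. \<not> int l dvd mat_det (M 1)}"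

text \<open>The Cartan subgroup R^x attached to R = Z_l[alpha], alpha^2 = t alpha - n,
  acting by left multiplication written in the basis {1, alpha}:
  x + y alpha  \<mapsto>  [[x, -n y], [y, x + t y]].\<close>
definition cartan0 :: "nat \<Rightarrow> (nat \<Rightarrow> int) \<Rightarrow> (nat \<Rightarrow> int) \<Rightarrow> lmat set" where
  "cartan0 l t nn = {M \<in> GL2 l. \<exists>x \<in> Zl l. \<exists>y \<in> Zl l.
      \<forall>k. M k = mat_mod (int l ^ k) (x k, - nn k * y k, y k, x k + t k * y k)}"

definition conj_set :: "nat \<Rightarrow> lmat \<Rightarrow> lmat set \<Rightarrow> lmat set" where
  "conj_set l g H = {M \<in> Zl_mat l. \<exists>X \<in> H. lmat_mul l M g = lmat_mul l g X}"

definition normalizer :: "nat \<Rightarrow> lmat set \<Rightarrow> lmat set" where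
  "normalizer l H = {h \<in> GL2 l. conj_set l h H = H}"

text \<open>The direct limit of (Z/l^n)^2, realized as (Z[1/l]/Z)^2 with representatives in [0,1)^2.\<close>
definition tors :: "nat \<Rightarrow> (rat \<times> rat) set" where
  "tors l = {(p,q). 0 \<le> p \<and> p < 1 \<and> 0 \<le> q \<and> q < 1 \<and>
      (\<exists>k. of_nat l ^ k * p \<in> \<int> \<and> of_nat l ^ k * q \<in> \<int>)}"

text \<open>Action of an l-adic matrix on it: an element (u/l^k, w/l^k) is sent to
  M_k (u,w) / l^k mod 1, where M_k is the reduction of M modulo l^k.\<close>
definition act :: "nat \<Rightarrow> lmat \<Rightarrow> rat \<times> rat \<Rightarrow> rat \<times> rat" where
  "act l M v = (case v of (p,q) \<Rightarrow>
     (let k = (LEAST k. of_nat l ^ k * p \<in> \<int> \<and> of_nat l ^ k * q \<in> \<int>);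
          u = \<lfloor>of_nat l ^ k * p\<rfloor>; w = \<lfloor>of_nat l ^ k * q\<rfloor> in
      (case M k of (a,b,c,d) \<Rightarrow>
        (frac (of_int (a*u + b*w) / of_nat l ^ k), frac (of_int (c*u + d*w) / of_nat l ^ k)))))"

definition kerMI :: "nat \<Rightarrow> lmat \<Rightarrow> (rat \<times> rat) set" where
  "kerMI l M = {v \<in> tors l. act l M v = v}"

definition tors_group :: "(rat \<times> rat) set \<Rightarrow> (rat \<times> rat) monoid" where
  "tors_group K = \<lparr>carrier = K,
     monoid.mult = (\<lambda>x y. (frac (fst x + fst y), frac (snd x + snd y))), one = (0,0)\<rparr>"

definition Mab :: "nat \<Rightarrow> nat \<Rightarrow> nat \<Rightarrow> lmat set \<Rightarrow> lmat set" where
  "Mab l a b G = {M \<in> G. tors_group (kerMI l M) \<cong>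
      DirProd (integer_mod_group (l ^ a)) (integer_mod_group (l ^ (a + b)))}"

text \<open>Normalized Haar measure (in the closed subgroup G) of a clopen subset S of G,
  computed as the limit of the proportions of the reductions modulo l^n.\<close>
definition haar :: "lmat set \<Rightarrow> lmat set \<Rightarrow> real" where
  "haar G S = lim (\<lambda>n. real (card ((\<lambda>M. M n) ` (G \<inter> S))) / real (card ((\<lambda>M. M n) ` G)))"

definition mu_star :: "nat \<Rightarrow> nat \<Rightarrow> nat \<Rightarrow> real" where
  "mu_star l a b = (if a = 0 then (if b = 0 then (real l - 2) / (real l - 1) else 1 / real l ^ b) else 0)"

end

theory Submission
  imports Defs "HOL-Number_Theory.Cong"
begin

text \<open>Let \<open>R = \<int>\<^sub>l[\<alpha>]\<close> and let \<open>\<sigma>\<close> be its conjugation \<open>\<alpha> \<mapsto> t - \<alpha>\<close>. Up to conjugation by \<open>g\<close> the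
  Cartan subgroup is \<open>R\<^sup>\<times>\<close> and its normalizer is the disjoint union of \<open>R\<^sup>\<times>\<close> and \<open>R\<^sup>\<times> \<sigma>\<close>; both halves
  have the same number of reductions, and these stay disjoint, modulo every \<open>l^n\<close> with \<open>n \<ge> 1\<close>.
  An element \<open>M = u \<sigma>\<close> has trace \<open>0\<close> and determinant \<open>- N(u)\<close>, where \<open>N\<close> is the norm form, and it is
  never the identity modulo \<open>l\<close>. Hence \<open>M - I\<close> has a unit entry, its kernel on the torsion points is
  cyclic, and its order is the exact power of \<open>l\<close> dividing \<open>det (M - I) = 1 - N(u)\<close>. Since the norm
  maps \<open>R\<^sup>\<times>\<close> onto the \<open>l\<close>-adic units (by a pigeonhole argument modulo \<open>l\<close> and Hensel lifting), the
  density of the \<open>u\<close> with \<open>N(u) - 1\<close> exactly divisible by \<open>l^b\<close> is the value of \<open>mu_star\<close> at \<open>a = 0\<close>.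
  On \<open>R\<^sup>\<times>\<close> no explicit value is needed: the proportions modulo \<open>l^n\<close> decrease with \<open>n\<close>, so they
  converge.\<close>

section \<open>Values of the norm form modulo powers of a prime\<close>

text \<open>\<open>qform t n x y\<close> is the norm of \<open>x + y \<alpha>\<close>, where
  \<alpha> is a root of \<open>X^2 - t X + n\<close>. That \<open>l\<close> does not divide
  \<open>t^2 - 4 n\<close> means that R is unramified, hence split or inert. Up to sign,
  \<open>t^2 - 4 n\<close> is the determinant of the linear map sending \<open>(x,y)\<close> to the
  gradient of the norm form, so this gradient does not vanish at units modulo \<open>l\<close>: this
  gives both the Hensel lifting and the disjointness of the two halves of the normalizer at every
  positive level.

  The prime 2 shapes many arguments: 2 is not invertible then, 1 has more than two square roots
  modulo \<open>2^n\<close>, and trace 0 does not exclude the identity modulo 2. Signs are therefore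
  decided in the integral domain of l-adic integers and not at a fixed level, and the identity
  modulo \<open>l\<close> is excluded through the discriminant.

  For given \<open>b\<close> the divisibility condition is visible modulo \<open>l^(b+1)\<close>, so
  on the twisted half the proportion is constant for levels above \<open>b\<close>.\<close>

definition qform :: "int \<Rightarrow> int \<Rightarrow> int \<Rightarrow> int \<Rightarrow> int" where
  "qform t n x y = x^2 + t * x * y + n * y^2"

definition box :: "int \<Rightarrow> (int \<times> int) set" where
  "box m = {0..<m} \<times> {0..<m}"

lemma finite_box [simp]: "finite (box m)"
  by (simp add: box_def)

lemma card_box: "card (box m) = (nat m)^2"
  by (simp add: box_def power2_eq_square)

lemma qform_cong:
  assumes "[x = x'] (mod m)" "[y = y'] (mod m)"
  shows "[qform t n x y = qform t n x' y'] (mod m)"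
  unfolding qform_def by (intro cong_add cong_mult cong_pow cong_refl assms)

lemma qform_cong_all:
  assumes "[t = t'] (mod m)" "[n = n'] (mod m)" "[x = x'] (mod m)" "[y = y'] (mod m)"
  shows "[qform t n x y = qform t' n' x' y'] (mod m)"
  unfolding qform_def by (intro cong_add cong_mult cong_pow cong_refl assms)

text \<open>Multiplicativity of the norm: the arguments on the left are the coordinates of
  \<open>(x + y \<alpha>) (x' + y' \<alpha>)\<close>.\<close>

lemma qform_mult:
  "qform t n (x * x' - n * y * y') (x * y' + y * x' + t * y * y') = qform t n x y * qform t n x' y'"
  unfolding qform_def by algebra

text \<open>Division with remainder by \<open>m\<close> in both coordinates. The set
  \<open>F p\<close> of admissible quotients may depend on the residue \<open>p\<close>, which is
  the form that Hensel lifting needs.\<close>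

lemma box_lift_bij:
  fixes m k :: int
  assumes "m > 0" "k > 0" "A \<subseteq> box m"
  shows "bij_betw (\<lambda>((a,b),(i,j)). (a + m * i, b + m * j)) (SIGMA p:A. F p \<inter> box k)
      {(x,y) \<in> box (m * k). (x mod m, y mod m) \<in> A \<and> (x div m, y div m) \<in> F (x mod m, y mod m)}"
(is "bij_betw ?f ?S ?T")
proof -
  define g where "g = (\<lambda>(x,y). ((x mod m, y mod m), (x div m, y div m)))"
  have r: "0 \<le> a + m * i \<and> a + m * i < m * k" if "0 \<le> a" "a < m" "0 \<le> i" "i < k" for a i
  proof
    show "0 \<le> a + m * i" using that assms by simp
    have "a + m * i < m * (i + 1)" using that by (simp add: algebra_simps)
    also have "\<dots> \<le> m * k" using that assms by (intro mult_left_mono) auto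
    finally show "a + m * i < m * k" .
  qed
  have d: "x div m < k" if "x < m * k" for x
  proof -
    have "m * (x div m) \<le> x" using assms by (simp flip: minus_mod_eq_mult_div)
    then have "m * (x div m) < m * k" using that by linarith
    then show ?thesis using assms by simp
  qed
  have 1: "?f ` ?S \<subseteq> ?T"
    using assms r by (fastforce simp: box_def)
  have 2: "g ` ?T \<subseteq> ?S"
    using assms by (auto simp: g_def box_def d pos_imp_zdiv_nonneg_iff)
  have 3: "\<forall>a\<in>?S. g (?f a) = a"
    using assms by (fastforce simp: g_def box_def)
  have 4: "\<forall>a\<in>?T. ?f (g a) = a"
    by (auto simp: g_def)
  show ?thesis by (rule bij_betw_byWitness[OF 3 4 1 2])
qed

lemma card_box_lift:
  fixes m k :: int
  assumes "m > 0" "k > 0" "A \<subseteq> box m"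
  shows "card {(x,y) \<in> box (m * k). (x mod m, y mod m) \<in> A} = (nat k)^2 * card A"
proof -
  have "card (SIGMA p:A. UNIV \<inter> box k) = card {(x,y) \<in> box (m * k). (x mod m, y mod m) \<in> A}"
    using bij_betw_same_card[OF box_lift_bij[OF assms, of "\<lambda>_. UNIV"]] by simp
  then show ?thesis by (simp add: card_cartesian_product card_box mult.commute)
qed

text \<open>One of the two coefficients is invertible modulo \<open>l\<close>; the variable of the
  other one is free and determines the rest, so the solutions form an affine line.\<close>

lemma card_linear_cong:
  fixes l :: nat and A B e :: int
  assumes "prime l" "\<not> (int l dvd A \<and> int l dvd B)"
  shows "card {(i,j) \<in> box (int l). int l dvd e + i * A + j * B} = l"
proof -
  have main: "card {(i,j) \<in> box (int l). int l dvd e + i * A + j * B} = l"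
    if nA: "\<not> int l dvd A" for A B
  proof -
    have l0: "int l > 0" using assms(1) prime_gt_0_nat by simp
    have "coprime A (int l)"
      using nA assms(1) by (metis coprime_commute prime_imp_coprime prime_nat_int_transfer)
    then obtain A' where A': "[A * A' = 1] (mod int l)"
      using cong_solve_coprime_int by blast
    have u: "int l dvd A * A' - 1" using A' by (simp add: cong_iff_dvd_diff)
    have key: "int l dvd e + i * A + j * B \<longleftrightarrow> [i = - (e + j * B) * A'] (mod int l)" for i j
    proof
      assume h: "int l dvd e + i * A + j * B"
      have "i - - (e + j * B) * A' = A' * (e + i * A + j * B) - i * (A * A' - 1)" by algebra
      then show "[i = - (e + j * B) * A'] (mod int l)"
        unfolding cong_iff_dvd_diff using h u by (simp only: dvd_diff dvd_mult)
    next
      assume "[i = - (e + j * B) * A'] (mod int l)"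
      then have h: "int l dvd i - - (e + j * B) * A'" by (simp only: cong_iff_dvd_diff)
      have "e + i * A + j * B = A * (i - - (e + j * B) * A') - (e + j * B) * (A * A' - 1)" by algebra
      then show "int l dvd e + i * A + j * B"
        using h u by (simp only: dvd_diff dvd_mult)
    qed
    have "{(i,j) \<in> box (int l). int l dvd e + i * A + j * B}
        = (\<lambda>j. ((- (e + j * B) * A') mod int l, j)) ` {0..<int l}" (is "?L = ?R")
    proof
      show "?L \<subseteq> ?R"
        using l0 by (auto simp: key box_def cong_def image_iff)
      show "?R \<subseteq> ?L"
        using l0 by (auto simp: key box_def cong_def)
    qed
    also have "card \<dots> = card {0..<int l}"
      by (intro card_image inj_onI) auto
    finally show ?thesis by simp
  qed
  show ?thesis
  proof (cases "int l dvd A")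
    case False
    then show ?thesis by (rule main)
  next
    case True
    then have "\<not> int l dvd B" using assms(2) by simp
    have "{(i,j) \<in> box (int l). int l dvd e + i * A + j * B}
       = prod.swap ` {(i,j) \<in> box (int l). int l dvd e + i * B + j * A}"
      by (force simp: box_def image_iff algebra_simps)
    then show ?thesis
      using main[OF \<open>\<not> int l dvd B\<close>, of A] by (simp add: card_image)
  qed
qed

section \<open>Solutions of the norm equation modulo powers of \<open>l\<close>\<close>

definition norm_one :: "nat \<Rightarrow> int \<Rightarrow> int \<Rightarrow> nat \<Rightarrow> (int \<times> int) set" where
  "norm_one l t n k = {(x,y) \<in> box (int l ^ k). [qform t n x y = 1] (mod int l ^ k)}"

text \<open>Reductions of units of R: being a unit is visible modulo \<open>l\<close>. At
  \<open>k = 0\<close> this set is empty, since the only pair is \<open>(0,0)\<close>, so all counts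
  start at level 1.\<close>

definition unit_pairs :: "nat \<Rightarrow> int \<Rightarrow> int \<Rightarrow> nat \<Rightarrow> (int \<times> int) set" where
  "unit_pairs l t n k = {(x,y) \<in> box (int l ^ k). \<not> int l dvd qform t n x y}"

text \<open>The two linear forms are the partial derivatives of the norm form. Cramer's rule
  applies, because their determinant is \<open>4 n - t^2\<close>.\<close>

lemma disc_gradient:
  fixes l :: int
  assumes "\<not> l dvd t^2 - 4 * n" "l dvd 2 * x + t * y" "l dvd t * x + 2 * n * y" and p: "prime l"
  shows "l dvd x \<and> l dvd y"
proof -
  have "(t^2 - 4 * n) * x = t * (t * x + 2 * n * y) - 2 * n * (2 * x + t * y)" by algebra
  then have "l dvd (t^2 - 4 * n) * x" using assms by (metis dvd_diff dvd_mult)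
  moreover have "(t^2 - 4 * n) * y = t * (2 * x + t * y) - 2 * (t * x + 2 * n * y)" by algebra
  then have "l dvd (t^2 - 4 * n) * y" using assms by (metis dvd_diff dvd_mult)
  ultimately show ?thesis using p assms(1) prime_dvd_mult_iff by blast
qed

text \<open>Hensel lifting as a count: the lifts of a solution modulo \<open>l^k\<close> are
  governed by one linear congruence modulo \<open>l\<close> whose coefficients are the gradient at
  that solution, so each solution has exactly \<open>l\<close> lifts.\<close>

lemma card_norm_one_Suc:
  fixes l :: nat
  assumes l: "prime l" and D: "\<not> int l dvd t^2 - 4 * n" and k: "k \<ge> 1"
  shows "card (norm_one l t n (Suc k)) = l * card (norm_one l t n k)"
proof -
  define m where "m = int l ^ k"
  have l0: "int l > 0" and m0: "m > 0" using l prime_gt_0_nat by (auto simp: m_def)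
  have lm: "int l dvd m" using k by (simp add: m_def)
  define F where "F = (\<lambda>(a,b). {(i,j). int l dvd (qform t n a b - 1) div m
      + i * (2 * a + t * b) + j * (t * a + 2 * n * b)})"
  define K where "K = norm_one l t n k"
  have KB: "K \<subseteq> box m" by (auto simp: K_def norm_one_def m_def)
  have lift: "[qform t n (a + m * i) (b + m * j) = 1] (mod m * int l) \<longleftrightarrow> (i,j) \<in> F (a,b)"
    if "(a,b) \<in> K" for a b i j
  proof -
    have "m dvd qform t n a b - 1"
      using that by (simp add: K_def norm_one_def m_def cong_iff_dvd_diff)
    then obtain e where e: "qform t n a b - 1 = m * e" by blast
    \<comment> \<open>The Taylor expansion is exact because the form is quadratic. The remainder
      \<open>m^2 qform t n i j\<close> vanishes modulo \<open>m * l\<close> since \<open>l\<close>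
      divides \<open>m\<close>, which is where \<open>k \<ge> 1\<close> enters.\<close>
    have "qform t n (a + m * i) (b + m * j) - 1
        = m * (e + i * (2 * a + t * b) + j * (t * a + 2 * n * b)) + m * (m * qform t n i j)"
      using e unfolding qform_def by algebra
    then have "m * int l dvd qform t n (a + m * i) (b + m * j) - 1
        \<longleftrightarrow> m * int l dvd m * (e + i * (2 * a + t * b) + j * (t * a + 2 * n * b)) + m * (m * qform t n i j)"
      by simp
    also have "\<dots> \<longleftrightarrow> m * int l dvd m * (e + i * (2 * a + t * b) + j * (t * a + 2 * n * b))"
      using lm by (intro dvd_add_left_iff mult_dvd_mono) auto
    finally show ?thesis using m0 e by (simp add: F_def cong_iff_dvd_diff)
  qed
  have "norm_one l t n (Suc k)
      = {(x,y) \<in> box (m * int l). (x mod m, y mod m) \<in> K \<and> (x div m, y div m) \<in> F (x mod m, y mod m)}"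
    (is "_ = ?R")
  proof -
    have "(x,y) \<in> norm_one l t n (Suc k) \<longleftrightarrow> (x,y) \<in> ?R" for x y
    proof (cases "(x mod m, y mod m) \<in> K")
      case True
      then show ?thesis
        using lift[OF True, of "x div m" "y div m"]
        by (simp add: norm_one_def m_def mult.commute)
    next
      case False
      moreover have "(x mod m, y mod m) \<in> K" if "(x,y) \<in> norm_one l t n (Suc k)"
      proof -
        have "[qform t n x y = 1] (mod m)"
          using that by (auto simp: norm_one_def m_def intro: cong_dvd_modulus)
        moreover have "[qform t n (x mod m) (y mod m) = qform t n x y] (mod m)"
          by (intro qform_cong) auto
        ultimately have "[qform t n (x mod m) (y mod m) = 1] (mod m)" by (rule cong_trans[rotated])
        then show ?thesis using m0 by (simp add: K_def norm_one_def box_def m_def)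
      qed
      ultimately show ?thesis by blast
    qed
    then show ?thesis by blast
  qed
  then have "card (norm_one l t n (Suc k)) = card (SIGMA p:K. F p \<inter> box (int l))"
    using bij_betw_same_card[OF box_lift_bij[OF m0 l0 KB, of F]] by simp
  also have "\<dots> = (\<Sum>p\<in>K. card (F p \<inter> box (int l)))"
    using finite_subset[OF KB] by (intro card_SigmaI) auto
  also have "\<dots> = (\<Sum>p\<in>K. l)"
  proof (rule sum.cong)
    fix p assume "p \<in> K"
    obtain a b where p: "p = (a,b)" by force
    \<comment> \<open>A vanishing gradient would make \<open>a\<close> and \<open>b\<close>
      divisible by \<open>l\<close>, and then the norm would be 0 and not 1 modulo
      \<open>l\<close>.\<close>
    have "\<not> (int l dvd 2 * a + t * b \<and> int l dvd t * a + 2 * n * b)"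
    proof
      assume "int l dvd 2 * a + t * b \<and> int l dvd t * a + 2 * n * b"
      then have "int l dvd a \<and> int l dvd b"
        using l by (intro disc_gradient[OF D]) auto
      then have "int l dvd qform t n a b"
        by (simp add: qform_def power2_eq_square)
      moreover have "int l dvd qform t n a b - 1"
        using \<open>p \<in> K\<close> p lm by (auto simp: K_def norm_one_def m_def cong_iff_dvd_diff intro: dvd_trans)
      ultimately have "int l dvd 1" by (metis dvd_diff_right_iff)
      then show False using l by (simp add: prime_nat_iff)
    qed
    from card_linear_cong[OF l this, of "(qform t n a b - 1) div m"]
    have "card {(i, j) \<in> box (int l). int l dvd (qform t n a b - 1) div m
      + i * (2 * a + t * b) + j * (t * a + 2 * n * b)} = l" .
    moreover have "F p \<inter> box (int l) = {(i, j) \<in> box (int l). int l dvd (qform t n a b - 1) div m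
      + i * (2 * a + t * b) + j * (t * a + 2 * n * b)}"
      by (auto simp: F_def p)
    ultimately show "card (F p \<inter> box (int l)) = l" by simp
  qed simp
  finally show ?thesis by (simp add: K_def)
qed

lemma card_norm_one:
  fixes l :: nat
  assumes "prime l" "\<not> int l dvd t^2 - 4 * n"
  shows "card (norm_one l t n (Suc k)) = l ^ k * card (norm_one l t n 1)"
  by (induction k) (simp_all add: card_norm_one_Suc[OF assms])

text \<open>For odd \<open>l\<close> complete the square: the \<open>(l+1)/2\<close> squares \<open>X\<^sup>2\<close> and the
  \<open>(l+1)/2\<close> values \<open>4 z + D y\<^sup>2\<close> modulo \<open>l\<close> must overlap.\<close>

lemma qform_surj:
  fixes l :: nat
  assumes l: "prime l" and D: "\<not> int l dvd t^2 - 4 * n" and z: "\<not> int l dvd z"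
  shows "\<exists>x y. [qform t n x y = z] (mod int l)"
proof (cases "l = 2")
  case True
  then have "[qform t n 1 0 = z] (mod int l)"
    using z by (simp add: qform_def cong_def mod2_eq_if)
  then show ?thesis by blast
next
  case False
  then have odd: "odd l" using l prime_odd_nat prime_ge_2_nat by (metis le_neq_implies_less)
  have pl: "prime (int l)" and l0: "int l > 0" using l prime_gt_0_nat by auto
  define D where "D = t^2 - 4 * n"
  define h where "h = (int l - 1) div 2"
  have h: "int l = 2 * h + 1" using odd by (auto simp: h_def elim: oddE)
  have h0: "h \<ge> 0" using h prime_gt_0_nat[OF l] by linarith
  have sq_inj: "x = y" if "x \<in> {0..h}" "y \<in> {0..h}" "int l dvd x^2 - y^2" for x y
  proof -
    have "int l dvd (x - y) * (x + y)" using that(3) by (simp add: power2_eq_square algebra_simps)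
    then consider "int l dvd x - y" | "int l dvd x + y" using pl prime_dvd_mult_iff by blast
    then show ?thesis
    proof cases
      case 1
      then show ?thesis using that h dvd_imp_le_int[of "x - y" "int l"] by force
    next
      case 2
      then have "x + y = 0" using that h zdvd_not_zless[of "x + y" "int l"] by force
      then show ?thesis using that by simp
    qed
  qed
  define S where "S = (\<lambda>x. x^2 mod int l) ` {0..h}"
  define T where "T = (\<lambda>y. (4 * z + D * y^2) mod int l) ` {0..h}"
  have cS: "card S = nat (h + 1)"
  proof -
    have "inj_on (\<lambda>x. x^2 mod int l) {0..h}"
      by (intro inj_onI sq_inj) (auto simp: mod_eq_dvd_iff)
    then show ?thesis by (simp add: S_def card_image)
  qed
  have cT: "card T = nat (h + 1)"
  proof -
    have "inj_on (\<lambda>y. (4 * z + D * y^2) mod int l) {0..h}"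
    proof (intro inj_onI sq_inj)
      fix x y assume "(4 * z + D * x^2) mod int l = (4 * z + D * y^2) mod int l"
      then have "int l dvd D * (x^2 - y^2)" by (simp add: mod_eq_dvd_iff algebra_simps)
      then show "int l dvd x^2 - y^2" using assms(2) pl prime_dvd_mult_iff D_def by blast
    qed
    then show ?thesis by (simp add: T_def card_image)
  qed
  have "S \<inter> T \<noteq> {}"
  proof
    assume "S \<inter> T = {}"
    then have "card (S \<union> T) = nat (h + 1) + nat (h + 1)"
      using cS cT by (subst card_Un_disjoint) (auto simp: S_def T_def)
    moreover have "card (S \<union> T) \<le> card {0..<int l}"
      using l0 pos_mod_bound[OF l0] pos_mod_sign[OF l0]
      by (intro card_mono) (auto simp: S_def T_def)
    ultimately show False using h h0 by simp
  qed
  then obtain w where "w \<in> S" "w \<in> T" by blast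
  then obtain X y where Xy: "X^2 mod int l = (4 * z + D * y^2) mod int l"
    unfolding S_def T_def by (elim imageE) metis
  have c2: "coprime (4::int) (int l)"
  proof -
    have "coprime (2^2::int) (int l)"
      using odd by (subst coprime_power_left_iff) simp
    moreover have "(2::int)^2 = 4" by simp
    ultimately show ?thesis by metis
  qed
  \<comment> \<open>\<open>h + 1\<close> is the inverse of 2 modulo \<open>l\<close>, as
    \<open>2 * (h + 1) = l + 1\<close>; thus \<open>x\<close> solves
    \<open>2 x + t y = X\<close>.\<close>
  define x where "x = (X - t * y) * (h + 1)"
  have "[2 * x + t * y = X] (mod int l)"
  proof -
    have "2 * x + t * y - X = int l * (X - t * y)" unfolding x_def h by algebra
    then show ?thesis by (simp add: cong_iff_dvd_diff)
  qed
  then have "[(2 * x + t * y)^2 - D * y^2 = X^2 - D * y^2] (mod int l)"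
    by (intro cong_diff cong_pow cong_refl)
  also have "[X^2 - D * y^2 = (4 * z + D * y^2) - D * y^2] (mod int l)"
    using Xy by (intro cong_diff cong_refl) (simp add: cong_def)
  finally have "[4 * qform t n x y = 4 * z] (mod int l)"
    by (simp add: D_def qform_def power2_eq_square algebra_simps)
  then have "[qform t n x y = z] (mod int l)"
    using c2 cong_mult_lcancel by blast
  then show ?thesis by blast
qed

text \<open>Multiplication by a fixed element of norm \<open>z\<close> maps the fibre of the norm
  over \<open>w\<close> injectively into the fibre over \<open>z * w\<close>.\<close>

lemma card_qform_fibre_le:
  fixes l :: nat
  assumes l: "prime l" and D: "\<not> int l dvd t^2 - 4 * n" and z: "\<not> int l dvd z"
  shows "card {(x,y) \<in> box (int l). [qform t n x y = w] (mod int l)}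
      \<le> card {(x,y) \<in> box (int l). [qform t n x y = z * w] (mod int l)}" (is "card ?A \<le> card ?B")
proof -
  have l0: "int l > 0" and pl: "prime (int l)" using l prime_gt_0_nat by auto
  obtain x0 y0 where z0: "[qform t n x0 y0 = z] (mod int l)"
    using qform_surj[OF assms] by blast
  define f where "f = (\<lambda>(x,y). ((x0 * x - n * y0 * y) mod int l, (x0 * y + y0 * x + t * y0 * y) mod int l))"
  have img: "f ` ?A \<subseteq> ?B"
  proof
    fix p assume "p \<in> f ` ?A"
    then obtain x y where xy: "[qform t n x y = w] (mod int l)" and p: "p = f (x,y)" by auto
    have "[qform t n ((x0 * x - n * y0 * y) mod int l) ((x0 * y + y0 * x + t * y0 * y) mod int l)
        = qform t n (x0 * x - n * y0 * y) (x0 * y + y0 * x + t * y0 * y)] (mod int l)"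
      by (intro qform_cong) auto
    also have "qform t n (x0 * x - n * y0 * y) (x0 * y + y0 * x + t * y0 * y)
        = qform t n x0 y0 * qform t n x y" by (rule qform_mult)
    also have "[\<dots> = z * w] (mod int l)" by (intro cong_mult z0 xy)
    finally show "p \<in> ?B" using l0 by (simp add: p f_def box_def)
  qed
  have nz: "\<not> int l dvd qform t n x0 y0"
    using z z0 by (metis cong_dvd_iff)
  have "inj_on f ?A"
  proof (intro inj_onI)
    fix p q assume p: "p \<in> ?A" and q: "q \<in> ?A" and e: "f p = f q"
    obtain x y x' y' where pq: "p = (x,y)" "q = (x',y')" by (metis surj_pair)
    define E1 E2 where "E1 = (x0 * x - n * y0 * y) - (x0 * x' - n * y0 * y')"
      and "E2 = (x0 * y + y0 * x + t * y0 * y) - (x0 * y' + y0 * x' + t * y0 * y')"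
    have E: "int l dvd E1" "int l dvd E2"
      using e by (auto simp: f_def pq mod_eq_dvd_iff E1_def E2_def)
    \<comment> \<open>Injectivity comes from multiplying \<open>E1 + E2 \<alpha>\<close> by the
      conjugate \<open>(x0 + t y0) - y0 \<alpha>\<close> of the fixed element; this and the
      analogous identity for \<open>y - y'\<close> are the two coordinates of the product.\<close>
    have "qform t n x0 y0 * (x - x') = (x0 + t * y0) * E1 + n * y0 * E2"
      by (simp add: E1_def E2_def qform_def power2_eq_square algebra_simps)
    moreover have "int l dvd (x0 + t * y0) * E1 + n * y0 * E2"
      by (intro dvd_add dvd_mult E)
    ultimately have "int l dvd qform t n x0 y0 * (x - x')" by simp
    then have xx: "int l dvd x - x'" using nz pl prime_dvd_mult_iff by blast
    have "qform t n x0 y0 * (y - y') = x0 * E2 - y0 * E1"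
      by (simp add: E1_def E2_def qform_def power2_eq_square algebra_simps)
    moreover have "int l dvd x0 * E2 - y0 * E1"
      by (intro dvd_diff dvd_mult E)
    ultimately have "int l dvd qform t n x0 y0 * (y - y')" by simp
    then have yy: "int l dvd y - y'" using nz pl prime_dvd_mult_iff by blast
    have "x mod int l = x' mod int l" "y mod int l = y' mod int l"
      using xx yy by (simp_all only: mod_eq_dvd_iff)
    then have "x = x'" "y = y'"
      using p q by (simp_all add: pq box_def)
    then show "p = q" by (simp add: pq)
  qed
  then show ?thesis by (rule card_inj_on_le[OF _ img]) (auto intro: finite_subset[OF _ finite_box[of "int l"]])
qed

text \<open>The norm is equidistributed over the \<open>l - 1\<close> unit residues: comparing
  fibres through \<open>z\<close> and through an inverse of \<open>z\<close> gives both
  inequalities.\<close>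

lemma card_unit_pairs_1:
  fixes l :: nat
  assumes l: "prime l" and D: "\<not> int l dvd t^2 - 4 * n"
  shows "card (unit_pairs l t n 1) = (l - 1) * card (norm_one l t n 1)"
proof -
  have l1: "int l > 1" using l prime_gt_1_nat by simp
  define Fi where "Fi = (\<lambda>z. {(x,y) \<in> box (int l). [qform t n x y = z] (mod int l)})"
  have fin: "finite (Fi z)" for z
    by (auto simp: Fi_def intro: finite_subset[OF _ finite_box[of "int l"]])
  have eq: "card (Fi z) = card (Fi 1)" if z: "\<not> int l dvd z" for z
  proof -
    have "coprime z (int l)"
      using z l by (metis coprime_commute prime_imp_coprime prime_nat_int_transfer)
    then obtain z' where z': "[z * z' = 1] (mod int l)" using cong_solve_coprime_int by blast
    have "\<not> int l dvd z'"
    proof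
      assume "int l dvd z'"
      then have "int l dvd 1" using z' by (metis cong_dvd_iff dvd_mult)
      then show False using l1 by simp
    qed
    from card_qform_fibre_le[OF l D this, of z]
    have "card (Fi z) \<le> card (Fi (z' * z))" by (simp add: Fi_def)
    also have "Fi (z' * z) = Fi 1"
      using z' by (auto simp: Fi_def mult.commute intro: cong_trans cong_sym)
    finally have "card (Fi z) \<le> card (Fi 1)" .
    moreover have "card (Fi 1) \<le> card (Fi z)"
      using card_qform_fibre_le[OF l D z, of 1] by (simp add: Fi_def)
    ultimately show ?thesis by simp
  qed
  have nd: "\<not> int l dvd z" if "z \<in> {1..<int l}" for z
    using that zdvd_not_zless by auto
  have "unit_pairs l t n 1 = (\<Union>z\<in>{1..<int l}. Fi z)"
  proof (intro subset_antisym subsetI)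
    fix p assume "p \<in> unit_pairs l t n 1"
    then obtain x y where p: "p = (x,y)" "(x,y) \<in> box (int l)" "\<not> int l dvd qform t n x y"
      by (auto simp: unit_pairs_def)
    then have "qform t n x y mod int l \<noteq> 0" by (simp add: dvd_eq_mod_eq_0)
    moreover have "0 \<le> qform t n x y mod int l" "qform t n x y mod int l < int l"
      using l1 by auto
    ultimately have "qform t n x y mod int l \<in> {1..<int l}" by simp
    moreover have "p \<in> Fi (qform t n x y mod int l)" using p by (simp add: Fi_def)
    ultimately show "p \<in> (\<Union>z\<in>{1..<int l}. Fi z)" by blast
  next
    fix p assume "p \<in> (\<Union>z\<in>{1..<int l}. Fi z)"
    then show "p \<in> unit_pairs l t n 1"
      using nd by (auto simp: Fi_def unit_pairs_def dest: cong_dvd_iff)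
  qed
  also have "card \<dots> = (\<Sum>z\<in>{1..<int l}. card (Fi z))"
  proof (rule card_UN_disjoint)
    show "\<forall>i\<in>{1..<int l}. \<forall>j\<in>{1..<int l}. i \<noteq> j \<longrightarrow> Fi i \<inter> Fi j = {}"
    proof (intro ballI impI)
      fix i j assume ij: "i \<in> {1..<int l}" "j \<in> {1..<int l}" "i \<noteq> j"
      show "Fi i \<inter> Fi j = {}"
        using ij by (auto simp: Fi_def cong_def)
    qed
  qed (auto simp: fin)
  also have "\<dots> = (\<Sum>z\<in>{1..<int l}. card (Fi 1))"
    by (intro sum.cong eq nd) auto
  also have "\<dots> = (l - 1) * card (Fi 1)" using l1 by (simp add: nat_diff_distrib)
  finally show ?thesis by (simp add: Fi_def norm_one_def)
qed

lemma card_norm_one_1_pos: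
  assumes "prime l"
  shows "card (norm_one l t n 1) > 0"
proof -
  have "(1,0) \<in> norm_one l t n 1"
    using prime_gt_1_nat[OF assms] by (simp add: norm_one_def box_def qform_def)
  moreover have "finite (norm_one l t n 1)"
    by (auto simp: norm_one_def intro: finite_subset[OF _ finite_box])
  ultimately show ?thesis by (auto simp: card_gt_0_iff)
qed

section \<open>Densities of norm conditions among the units\<close>

lemma card_unit_pairs:
  fixes l :: nat
  assumes l: "prime l"
  shows "card (unit_pairs l t n (Suc k)) = l ^ (2 * k) * card (unit_pairs l t n 1)"
proof -
  have l0: "int l > 0" using l prime_gt_0_nat by simp
  have "unit_pairs l t n (Suc k)
      = {(x,y) \<in> box (int l * int l ^ k). (x mod int l, y mod int l) \<in> unit_pairs l t n 1}"
  proof -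
    have "int l dvd qform t n (x mod int l) (y mod int l) \<longleftrightarrow> int l dvd qform t n x y" for x y
      by (intro cong_dvd_iff qform_cong) auto
    then show ?thesis using l0 by (auto simp: unit_pairs_def box_def)
  qed
  also have "card \<dots> = (nat (int l ^ k))^2 * card (unit_pairs l t n 1)"
    using l0 by (intro card_box_lift) (auto simp: unit_pairs_def)
  also have "nat (int l ^ k) = l ^ k" by (metis nat_int of_nat_power)
  finally show ?thesis by (simp add: power_mult power2_eq_square power_mult_distrib mult.commute)
qed

lemma card_norm_cong:
  fixes l :: nat
  assumes l: "prime l" and "k \<le> m"
  shows "card {(x,y) \<in> box (int l ^ m). int l ^ k dvd qform t n x y - 1}
      = l ^ (2 * (m - k)) * card (norm_one l t n k)"
proof -
  have l0: "int l ^ j > 0" for j using l prime_gt_0_nat by simp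
  have "{(x,y) \<in> box (int l ^ m). int l ^ k dvd qform t n x y - 1}
      = {(x,y) \<in> box (int l ^ k * int l ^ (m - k)). (x mod int l ^ k, y mod int l ^ k) \<in> norm_one l t n k}"
  proof -
    have "[qform t n (x mod int l ^ k) (y mod int l ^ k) = 1] (mod int l ^ k)
        \<longleftrightarrow> [qform t n x y = 1] (mod int l ^ k)" for x y
      by (intro cong_cong_mod_int[THEN iffD1] iffI; meson cong_trans cong_sym qform_cong cong_mod_left cong_refl)
    then show ?thesis using l0 assms(2)
      by (auto simp: norm_one_def box_def cong_iff_dvd_diff simp flip: power_add)
  qed
  also have "card \<dots> = (nat (int l ^ (m - k)))^2 * card (norm_one l t n k)"
    using l0 by (intro card_box_lift) (auto simp: norm_one_def)
  also have "nat (int l ^ (m - k)) = l ^ (m - k)" by (metis nat_int of_nat_power)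
  finally show ?thesis by (simp add: power_mult power2_eq_square power_mult_distrib mult.commute)
qed

text \<open>Norms congruent to 1 modulo \<open>l^(k+1)\<close> have share
  \<open>1 / ((l-1) l^k)\<close> among the units, and exact divisibility is a difference of two
  consecutive shares. For \<open>b = 0\<close> the larger share is 1, which yields
  \<open>(l-2)/(l-1)\<close>; for \<open>b > 0\<close> the difference is
  \<open>l^(-b)\<close>.\<close>

lemma card_norm_exact:
  fixes l :: nat
  assumes l: "prime l" and D: "\<not> int l dvd t^2 - 4 * n" and m: "m > b"
  shows "real (card {(x,y) \<in> unit_pairs l t n m. int l ^ b dvd qform t n x y - 1
        \<and> \<not> int l ^ Suc b dvd qform t n x y - 1}) / real (card (unit_pairs l t n m)) = mu_star l 0 b"
proof -
  have l1: "l > 1" using l prime_gt_1_nat by simp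
  define A where "A = (\<lambda>k. {(x,y) \<in> unit_pairs l t n m. int l ^ k dvd qform t n x y - 1})"
  have fU: "finite (unit_pairs l t n m)"
    by (auto simp: unit_pairs_def intro: finite_subset[OF _ finite_box])
  then have fA: "finite (A k)" for k by (auto simp: A_def intro: finite_subset)
  define c where "c = real (card (norm_one l t n 1))"
  have c: "c > 0" using card_norm_one_1_pos[OF l] by (simp add: c_def)
  obtain m' where m': "m = Suc m'" using m by (cases m) auto
  have U: "real (card (unit_pairs l t n m)) = real l ^ (2 * m') * ((real l - 1) * c)"
    using l1 by (simp add: m' card_unit_pairs[OF l, of _ _ m'] card_unit_pairs_1[OF l D, simplified] c_def of_nat_diff)
  have A_pos: "real (card (A (Suc k))) = real l ^ (2 * m' - k) * c" if "Suc k \<le> m" for k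
  proof -
    have "A (Suc k) = {(x,y) \<in> box (int l ^ m). int l ^ Suc k dvd qform t n x y - 1}"
    proof -
      have "\<not> int l dvd q" if "int l ^ Suc k dvd q - 1" for q
      proof
        assume "int l dvd q"
        moreover have "int l dvd q - 1" using that by (auto intro: dvd_trans)
        ultimately have "int l dvd 1" by (metis dvd_diff_right_iff)
        then show False using l1 by simp
      qed
      then show ?thesis by (auto simp: A_def unit_pairs_def)
    qed
    then have "card (A (Suc k)) = l ^ (2 * (m - Suc k)) * (l ^ k * card (norm_one l t n 1))"
      using card_norm_cong[OF l that, of t n] card_norm_one[OF l D, of k] by simp
    also have "\<dots> = l ^ (2 * m' - k) * card (norm_one l t n 1)"
    proof -
      have "2 * (m - Suc k) + k = 2 * m' - k" using that by (simp add: m')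
      then show ?thesis by (metis mult.assoc power_add)
    qed
    finally show ?thesis by (simp add: c_def)
  qed
  have "{(x,y) \<in> unit_pairs l t n m. int l ^ b dvd qform t n x y - 1
        \<and> \<not> int l ^ Suc b dvd qform t n x y - 1} = A b - A (Suc b)"
    by (auto simp: A_def)
  moreover have "A (Suc b) \<subseteq> A b" by (auto simp: A_def dest: dvd_mult_right)
  ultimately have "real (card {(x,y) \<in> unit_pairs l t n m. int l ^ b dvd qform t n x y - 1
        \<and> \<not> int l ^ Suc b dvd qform t n x y - 1}) = real (card (A b)) - real (card (A (Suc b)))"
    using card_Diff_subset[OF fA] card_mono[OF fA] by (simp add: of_nat_diff)
  also have "\<dots> / real (card (unit_pairs l t n m)) = mu_star l 0 b"
  proof (cases b)
    case 0
    have "A 0 = unit_pairs l t n m" by (auto simp: A_def)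
    then show ?thesis using A_pos[of 0] m l1 c U
      by (simp add: 0 mu_star_def divide_simps m') (simp add: algebra_simps)
  next
    case (Suc k)
    have "k + b + 1 \<le> 2 * m'" using m by (simp add: m' Suc)
    then obtain r where r: "2 * m' = r + Suc (Suc (k + k))" by (metis Suc Suc_eq_plus1 add_Suc_right le_add_diff_inverse2)
    have "real (card (A b)) = real l ^ (r + k + 2) * c" "real (card (A (Suc b))) = real l ^ (r + k + 1) * c"
      using A_pos[of k] A_pos[of b] m r by (simp_all add: Suc)
    then show ?thesis using U r l1 c
      by (simp add: Suc mu_star_def divide_simps power_add) (simp add: algebra_simps)
  qed
  finally show ?thesis .
qed

section \<open>Coherent sequences\<close>

lemma Zl_iff:
  assumes "l > 0"
  shows "x \<in> Zl l \<longleftrightarrow> (\<forall>n. x (Suc n) mod int l ^ n = x n)"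
proof -
  have "0 \<le> x n \<and> x n < int l ^ n" if "x (Suc n) mod int l ^ n = x n" for n
    using that assms by (metis pos_mod_bound pos_mod_sign of_nat_0_less_iff zero_less_power)
  then show ?thesis by (auto simp: Zl_def)
qed

lemma Zl_mat_iff:
  assumes "l > 0"
  shows "(\<lambda>n. (a n, b n, c n, d n)) \<in> Zl_mat l \<longleftrightarrow> a \<in> Zl l \<and> b \<in> Zl l \<and> c \<in> Zl l \<and> d \<in> Zl l"
proof -
  have "x n = x n mod int l ^ n" if "x (Suc n) mod int l ^ n = x n" for x :: "nat \<Rightarrow> int" and n
    using that by (metis mod_mod_trivial)
  then show ?thesis
    unfolding Zl_iff[OF assms] Zl_mat_def mem_Collect_eq mat_mod.simps prod.inject by blast
qed

lemma lmat_cases: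
  obtains a b c d :: "nat \<Rightarrow> int" where "M = (\<lambda>n. (a n, b n, c n, d n))"
proof
  show "M = (\<lambda>n. ((fst \<circ> M) n, (fst \<circ> snd \<circ> M) n, (fst \<circ> snd \<circ> snd \<circ> M) n, (snd \<circ> snd \<circ> snd \<circ> M) n))"
    by simp
qed

lemma Zl_mat_cases:
  assumes "M \<in> Zl_mat l" "l > 0"
  obtains a b c d where "M = (\<lambda>n. (a n, b n, c n, d n))" "a \<in> Zl l" "b \<in> Zl l" "c \<in> Zl l" "d \<in> Zl l"
proof -
  obtain a b c d where M: "M = (\<lambda>n. (a n, b n, c n, d n))" by (rule lmat_cases)
  then show thesis using assms that Zl_mat_iff by blast
qed

text \<open>Like \<open>Zl\<close>, but without requiring reduced residues, so that ring operations
  can be applied termwise.\<close>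

definition coherent :: "nat \<Rightarrow> (nat \<Rightarrow> int) \<Rightarrow> bool" where
  "coherent l x \<longleftrightarrow> (\<forall>n. [x (Suc n) = x n] (mod int l ^ n))"

lemma coherent_cong:
  assumes "coherent l x" "m \<le> n"
  shows "[x n = x m] (mod int l ^ m)"
  using assms(2)
proof (induction n rule: dec_induct)
  case (step k)
  have "[x (Suc k) = x k] (mod int l ^ m)"
    using assms(1) step.hyps by (auto simp: coherent_def intro: cong_dvd_modulus le_imp_power_dvd)
  then show ?case using step.IH by (rule cong_trans)
qed simp

lemma Zl_coherent: "x \<in> Zl l \<Longrightarrow> coherent l x"
  by (simp add: Zl_def coherent_def cong_def)

lemma coherent_const: "coherent l (\<lambda>_. k)"
  by (simp add: coherent_def)

lemma coherent_add: "coherent l x \<Longrightarrow> coherent l y \<Longrightarrow> coherent l (\<lambda>n. x n + y n)"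
  unfolding coherent_def by (blast intro: cong_add)

lemma coherent_diff: "coherent l x \<Longrightarrow> coherent l y \<Longrightarrow> coherent l (\<lambda>n. x n - y n)"
  unfolding coherent_def by (blast intro: cong_diff)

lemma coherent_mult: "coherent l x \<Longrightarrow> coherent l y \<Longrightarrow> coherent l (\<lambda>n. x n * y n)"
  unfolding coherent_def by (blast intro: cong_mult)

lemma coherent_cong_trans:
  assumes "coherent l x" "\<And>n. [y n = x n] (mod int l ^ n)"
  shows "coherent l y"
  unfolding coherent_def
proof
  fix n
  have "[y (Suc n) = x (Suc n)] (mod int l ^ n)"
    using assms(2)[of "Suc n"] by (rule cong_dvd_modulus) simp
  also have "[x (Suc n) = x n] (mod int l ^ n)" using assms(1) by (simp add: coherent_def)
  also have "[x n = y n] (mod int l ^ n)" by (rule cong_sym[OF assms(2)])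
  finally show "[y (Suc n) = y n] (mod int l ^ n)" .
qed

lemma coherent_uminus: "coherent l x \<Longrightarrow> coherent l (\<lambda>n. - x n)"
  using coherent_diff[OF coherent_const[of l 0]] by simp

lemma coherent_mod_Zl:
  assumes "coherent l x" "l > 0"
  shows "(\<lambda>n. x n mod int l ^ n) \<in> Zl l"
  unfolding Zl_iff[OF assms(2)]
proof
  fix n
  have "x (Suc n) mod int l ^ Suc n mod int l ^ n = x (Suc n) mod int l ^ n"
    by (rule mod_mod_cancel) simp
  then show "x (Suc n) mod int l ^ Suc n mod int l ^ n = x n mod int l ^ n"
    using assms(1) by (simp add: coherent_def cong_def)
qed

text \<open>The l-adic integers form an integral domain. If \<open>x\<close> is nonzero at level
  \<open>i\<close> and \<open>y\<close> at level \<open>j\<close>, their valuations are below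
  \<open>i\<close> and \<open>j\<close>, so the product is nonzero at level \<open>i + j\<close>. A
  single level would not suffice, as zero divisors exist modulo \<open>l^n\<close>.\<close>

lemma coherent_zero_divisor:
  fixes x y :: "nat \<Rightarrow> int"
  assumes l: "prime l" and x: "coherent l x" and y: "coherent l y"
    and xy: "\<And>n. int l ^ n dvd x n * y n"
  shows "(\<forall>n. int l ^ n dvd x n) \<or> (\<forall>n. int l ^ n dvd y n)"
proof (rule ccontr)
  assume "\<not> ?thesis"
  then obtain i j where i: "\<not> int l ^ i dvd x i" and j: "\<not> int l ^ j dvd y j" by blast
  have i': "\<not> int l ^ i dvd x (i + j)"
    using i cong_dvd_iff[OF coherent_cong[OF x, of i "i + j"]] by simp
  have j': "\<not> int l ^ j dvd y (i + j)"
    using j cong_dvd_iff[OF coherent_cong[OF y, of j "i + j"]] by simp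
  have pl: "prime_elem (int l)" using l by simp
  have nz: "x (i + j) \<noteq> 0" "y (i + j) \<noteq> 0" using i' j' by auto
  have nu: "\<not> is_unit (int l)" using prime_gt_1_nat[OF l] by simp
  have "i + j \<le> multiplicity (int l) (x (i + j) * y (i + j))"
    using xy[of "i + j"] nz nu by (intro multiplicity_geI) auto
  also have "\<dots> = multiplicity (int l) (x (i + j)) + multiplicity (int l) (y (i + j))"
    using pl nz by (rule prime_elem_multiplicity_mult_distrib)
  also have "multiplicity (int l) (x (i + j)) < i"
    using i' nz nu by (intro multiplicity_lessI) auto
  also have "multiplicity (int l) (y (i + j)) < j"
    using j' nz nu by (intro multiplicity_lessI) auto
  finally show False by simp
qed

section \<open>Kernels on the torsion points\<close>

definition tors_pt :: "nat \<Rightarrow> nat \<Rightarrow> int \<Rightarrow> int \<Rightarrow> rat \<times> rat" where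
  "tors_pt l n u w = (frac (of_int u / of_nat l ^ n), frac (of_int w / of_nat l ^ n))"

lemma frac_of_int_div:
  assumes "l > 0"
  shows "frac (of_int u / of_nat l ^ n :: rat) = of_int (u mod int l ^ n) / of_nat l ^ n"
proof -
  have e: "(of_nat l ^ n :: rat) = of_int (int l ^ n)" by simp
  have "\<lfloor>of_int u / of_nat l ^ n :: rat\<rfloor> = u div int l ^ n"
    unfolding e by (rule floor_divide_of_int_eq)
  then have "frac (of_int u / of_nat l ^ n :: rat) = of_int u / of_nat l ^ n - of_int (u div int l ^ n)"
    by (simp add: frac_def)
  also have "\<dots> = (of_int u - of_int (int l ^ n * (u div int l ^ n))) / of_nat l ^ n"
    using assms by (simp add: field_simps)
  also have "\<dots> = of_int (u mod int l ^ n) / of_nat l ^ n"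
    by (simp only: of_int_diff [symmetric] minus_mult_div_eq_mod)
  finally show ?thesis .
qed

lemma tors_pt_eq_iff:
  assumes "l > 0"
  shows "tors_pt l n u w = tors_pt l n u' w' \<longleftrightarrow> [u = u'] (mod int l ^ n) \<and> [w = w'] (mod int l ^ n)"
  using assms by (simp add: tors_pt_def frac_of_int_div cong_def)

lemma tors_pt_scale:
  assumes "l > 0"
  shows "tors_pt l (k + n) (int l ^ k * u) (int l ^ k * w) = tors_pt l n u w"
  using assms by (simp add: tors_pt_def power_add)

lemma tors_pt_add:
  "(frac (fst (tors_pt l n u w) + fst (tors_pt l n u' w')), frac (snd (tors_pt l n u w) + snd (tors_pt l n u' w')))
    = tors_pt l n (u + u') (w + w')"
proof -
  have "frac (frac x + frac y) = frac (x + y)" for x y :: rat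
  proof -
    have "frac x + frac y = x + y - of_int (\<lfloor>x\<rfloor> + \<lfloor>y\<rfloor>)" by (simp add: frac_def)
    then have "frac x + frac y = x + y + of_int (- (\<lfloor>x\<rfloor> + \<lfloor>y\<rfloor>))" by simp
    then show ?thesis by (simp only: frac_add_of_int_right)
  qed
  then show ?thesis by (simp add: tors_pt_def add_divide_distrib)
qed

lemma tors_pt_in_tors:
  assumes "l > 0"
  shows "tors_pt l n u w \<in> tors l"
proof -
  have "of_nat l ^ n * fst (tors_pt l n u w) \<in> \<int> \<and> of_nat l ^ n * snd (tors_pt l n u w) \<in> \<int>"
    using assms by (simp add: tors_pt_def frac_of_int_div)
  then show ?thesis by (auto simp: tors_def tors_pt_def frac_lt_1)
qed

text \<open>The denominator can be enlarged beyond any bound \<open>N\<close>, which allows a point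
  to be examined at a level where the valuation of the determinant is already visible.\<close>

lemma torsE:
  assumes "v \<in> tors l" "l > 0"
  obtains n u w where "n \<ge> N" "v = tors_pt l n u w"
proof -
  obtain p q k where v: "v = (p,q)" "0 \<le> p" "p < 1" "0 \<le> q" "q < 1"
    and k: "of_nat l ^ k * p \<in> \<int>" "of_nat l ^ k * q \<in> \<int>"
    using assms(1) by (auto simp: tors_def)
  obtain u w where "of_nat l ^ k * p = of_int u" "of_nat l ^ k * q = of_int w"
    using k by (auto elim!: Ints_cases)
  then have "p = of_int u / of_nat l ^ k" "q = of_int w / of_nat l ^ k"
    using assms(2) by (simp_all add: field_simps)
  then have "v = tors_pt l k u w"
    using v by (simp add: tors_pt_def frac_eq[THEN iffD2])
  then have "v = tors_pt l (N + k) (int l ^ N * u) (int l ^ N * w)"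
    using tors_pt_scale[OF assms(2)] by simp
  then show thesis using that[of "N + k"] by simp
qed

text \<open>\<open>act\<close> works with the least common denominator \<open>l^k\<close>, whereas
  linear algebra needs an arbitrary one. Both agree because \<open>M n\<close> reduces to
  \<open>M k\<close> and numerators at level \<open>n\<close> are multiples of
  \<open>l^(n-k)\<close>.\<close>

lemma act_tors_pt:
  assumes l: "l > 0" and M: "M = (\<lambda>n. (a n, b n, c n, d n))" "M \<in> Zl_mat l"
  shows "act l M (tors_pt l n u w) = tors_pt l n (a n * u + b n * w) (c n * u + d n * w)"
proof -
  define p q where "p = fst (tors_pt l n u w)" and "q = snd (tors_pt l n u w)"
  define P where "P = (\<lambda>k. of_nat l ^ k * p \<in> \<int> \<and> of_nat l ^ k * q \<in> \<int>)"
  define k where "k = (LEAST k. P k)"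
  have n: "of_nat l ^ n * p = of_int (u mod int l ^ n)" "of_nat l ^ n * q = of_int (w mod int l ^ n)"
    using l by (simp_all add: p_def q_def tors_pt_def frac_of_int_div)
  then have "P n" by (simp add: P_def)
  then have Pk: "P k" and kn: "k \<le> n" unfolding k_def by (rule LeastI, rule Least_le)
  obtain u' w' where uw: "of_nat l ^ k * p = of_int u'" "of_nat l ^ k * q = of_int w'"
    using Pk by (auto simp: P_def elim!: Ints_cases)
  define j where "j = n - k"
  have n_eq: "n = j + k" using kn by (simp add: j_def)
  have "of_int (int l ^ j * z) = (of_nat l ^ n * x :: rat)" if "of_nat l ^ k * x = of_int z" for x z
    using that[symmetric] by (simp add: n_eq power_add)
  then have "of_int (int l ^ j * u') = (of_int (u mod int l ^ n) :: rat)"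
    "of_int (int l ^ j * w') = (of_int (w mod int l ^ n) :: rat)"
    using uw n by metis+
  then have u': "int l ^ j * u' = u mod int l ^ n" and w': "int l ^ j * w' = w mod int l ^ n"
    by (simp_all only: of_int_eq_iff)
  have "act l M (tors_pt l n u w) = act l M (p,q)" by (simp add: p_def q_def)
  also have "\<dots> = tors_pt l k (a k * u' + b k * w') (c k * u' + d k * w')"
    unfolding act_def P_def[symmetric] k_def[symmetric] tors_pt_def
    by (simp add: uw Let_def M flip: k_def P_def)
  also have "\<dots> = tors_pt l n (int l ^ j * (a k * u' + b k * w')) (int l ^ j * (c k * u' + d k * w'))"
    unfolding n_eq by (rule tors_pt_scale[OF l, symmetric])
  also have "\<dots> = tors_pt l n (a n * u + b n * w) (c n * u + d n * w)"
  proof -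
    have row: "[int l ^ j * (x k * u' + y k * w') = x n * u + y n * w] (mod int l ^ n)"
      if "x \<in> Zl l" "y \<in> Zl l" for x y
    proof -
      have "[x k = x n] (mod int l ^ k)" "[y k = y n] (mod int l ^ k)"
        using that by (simp_all add: cong_sym[OF coherent_cong[OF Zl_coherent kn]])
      then have "[x k * u' + y k * w' = x n * u' + y n * w'] (mod int l ^ k)"
        by (intro cong_add cong_mult cong_refl)
      then have "[int l ^ j * (x k * u' + y k * w') = int l ^ j * (x n * u' + y n * w')] (mod int l ^ n)"
        unfolding n_eq power_add by (rule cong_cmult_leftI)
      also have "int l ^ j * (x n * u' + y n * w') = x n * (int l ^ j * u') + y n * (int l ^ j * w')"
        by (simp add: algebra_simps)
      also have "[\<dots> = x n * u + y n * w] (mod int l ^ n)"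
        unfolding u' w' by (intro cong_add cong_mult cong_refl) auto
      finally show ?thesis .
    qed
    have "a \<in> Zl l" "b \<in> Zl l" "c \<in> Zl l" "d \<in> Zl l"
      using M Zl_mat_iff[OF l] by simp_all
    then show ?thesis using row by (simp add: tors_pt_eq_iff[OF l])
  qed
  finally show ?thesis .
qed

lemma kerMI_tors_pt:
  assumes l: "l > 0" and M: "M = (\<lambda>n. (a n, b n, c n, d n))" "M \<in> Zl_mat l"
  shows "tors_pt l n u w \<in> kerMI l M \<longleftrightarrow>
    int l ^ n dvd (a n - 1) * u + b n * w \<and> int l ^ n dvd c n * u + (d n - 1) * w"
proof -
  have e: "a n * u + b n * w - u = (a n - 1) * u + b n * w" "c n * u + d n * w - w = c n * u + (d n - 1) * w"
    by algebra+
  show ?thesis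
    unfolding kerMI_def mem_Collect_eq act_tors_pt[OF assms] tors_pt_eq_iff[OF l] cong_iff_dvd_diff e
    using tors_pt_in_tors[OF l] by blast
qed

section \<open>Linear systems with a unimodular row\<close>

lemma unimodular_bezout:
  fixes l :: nat and p q :: int
  assumes l: "prime l" and pq: "\<not> (int l dvd p \<and> int l dvd q)"
  obtains e f where "int l ^ n dvd e * p + f * q - 1"
proof -
  have "\<not> int l dvd gcd p q" using pq by simp
  then have "coprime (gcd p q) (int l)"
    using l by (metis coprime_commute prime_imp_coprime prime_nat_int_transfer)
  then have "coprime (gcd p q) (int l ^ n)" by simp
  then obtain z where z: "[gcd p q * z = 1] (mod int l ^ n)" using cong_solve_coprime_int by blast
  obtain e f where g: "e * p + f * q = gcd p q" using bezout_int by blast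
  have "(z * e) * p + (z * f) * q = gcd p q * z" unfolding g[symmetric] by algebra
  then have "int l ^ n dvd (z * e) * p + (z * f) * q - 1" using z by (simp add: cong_iff_dvd_diff)
  then show thesis by (rule that)
qed

text \<open>A unimodular row \<open>(p,q)\<close> forces \<open>(u,w) = k (-q,p)\<close> with \<open>k\<close> killed by the determinant.\<close>

lemma unimodular_row_solutions:
  fixes m :: int
  assumes ef: "m dvd e * p + f * q - 1" and 1: "m dvd p * u + q * w" and 2: "m dvd r * u + s * w"
  defines "k \<equiv> e * w - f * u"
  shows "[u = - q * k] (mod m)" "[w = p * k] (mod m)" "m dvd (p * s - q * r) * k"
proof -
  have "u - - q * k = e * (p * u + q * w) - u * (e * p + f * q - 1)" unfolding k_def by algebra
  moreover have "m dvd e * (p * u + q * w) - u * (e * p + f * q - 1)"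
    by (intro dvd_diff dvd_mult 1 ef)
  ultimately show u: "[u = - q * k] (mod m)"
    by (simp only: cong_iff_dvd_diff)
  have "w - p * k = f * (p * u + q * w) - w * (e * p + f * q - 1)" unfolding k_def by algebra
  moreover have "m dvd f * (p * u + q * w) - w * (e * p + f * q - 1)"
    by (intro dvd_diff dvd_mult 1 ef)
  ultimately show w: "[w = p * k] (mod m)"
    by (simp only: cong_iff_dvd_diff)
  have "[r * u + s * w = r * (- q * k) + s * (p * k)] (mod m)"
    by (intro cong_add cong_mult cong_refl u w)
  moreover have "r * (- q * k) + s * (p * k) = (p * s - q * r) * k"
    by algebra
  ultimately show "m dvd (p * s - q * r) * k"
    using 2 by (metis cong_dvd_iff)
qed

text \<open>The Bezout combination recovers \<open>k\<close> from the vector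
  \<open>k (-q,p)\<close>, so different classes of \<open>k\<close> give different points.\<close>

lemma unimodular_cancel:
  fixes m :: int
  assumes "m dvd e * p + f * q - 1" "[- q * k = - q * k'] (mod m)" "[p * k = p * k'] (mod m)"
  shows "[k = k'] (mod m)"
proof -
  have "k - k' = e * (p * k - p * k') - f * (- q * k - - q * k') - (k - k') * (e * p + f * q - 1)"
    by algebra
  moreover have "m dvd e * (p * k - p * k') - f * (- q * k - - q * k') - (k - k') * (e * p + f * q - 1)"
    using assms unfolding cong_iff_dvd_diff by (meson dvd_diff dvd_mult)
  ultimately show ?thesis by (simp only: cong_iff_dvd_diff)
qed

text \<open>At level \<open>n\<close> the kernel consists of the multiples \<open>k (-q,p)\<close>
  with \<open>l^n\<close> dividing \<open>k D\<close>, where \<open>D\<close> is the determinant. As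
  \<open>D\<close> has valuation \<open>v\<close>, this forces \<open>l^(n-v)\<close> to divide
  \<open>k\<close>, so every kernel point already lives at level \<open>v\<close>, as a multiple of
  one generator.\<close>

lemma tors_group_cyclic:
  fixes p q r s :: "nat \<Rightarrow> int"
  assumes l: "prime l" and K: "K \<subseteq> tors l"
    and Kt: "\<And>n u w. tors_pt l n u w \<in> K \<longleftrightarrow> int l ^ n dvd p n * u + q n * w \<and> int l ^ n dvd r n * u + s n * w"
    and coh: "coherent l p" "coherent l q" "coherent l r" "coherent l s"
    and pq: "\<not> (int l dvd p 1 \<and> int l dvd q 1)"
    and v: "int l ^ v dvd p (Suc v) * s (Suc v) - q (Suc v) * r (Suc v)"
      "\<not> int l ^ Suc v dvd p (Suc v) * s (Suc v) - q (Suc v) * r (Suc v)"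
  shows "integer_mod_group (l ^ v) \<cong> tors_group K"
proof -
  have l0: "l > 0" using l prime_gt_0_nat by simp
  define D where "D = (\<lambda>n. p n * s n - q n * r n)"
  have Dcoh: "coherent l D" unfolding D_def by (intro coherent_diff coherent_mult coh)
  \<comment> \<open>The generator is read at level \<open>Suc v\<close> although it is used modulo
    \<open>l^v\<close>: for \<open>v = 0\<close> level \<open>v\<close> carries no information, and
    unimodularity is known only from level 1 on.\<close>
  define P Q where "P = p (Suc v)" and "Q = q (Suc v)"
  have uni: "\<not> (int l dvd p n \<and> int l dvd q n)" if "n \<ge> 1" for n
    using pq that coherent_cong[OF coh(1) that] coherent_cong[OF coh(2) that] by (auto simp: cong_dvd_iff)
  define f where "f = (\<lambda>k. tors_pt l v (- Q * k) (P * k))"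
  have pv: "[P = p n] (mod int l ^ v)" "[Q = q n] (mod int l ^ v)" if "n \<ge> v" for n
    unfolding P_def Q_def
    by (meson that coherent_cong coh cong_sym cong_trans le_SucI order_refl)+
  have in_K: "f k \<in> K" for k
    unfolding f_def Kt
  proof
    have "[p v * (- Q * k) + q v * (P * k) = P * (- Q * k) + Q * (P * k)] (mod int l ^ v)"
      by (intro cong_add cong_mult cong_refl cong_sym[OF pv(1)] cong_sym[OF pv(2)]) auto
    then show "int l ^ v dvd p v * (- Q * k) + q v * (P * k)"
      by (simp add: cong_iff_dvd_diff)
    have "[r v * (- Q * k) + s v * (P * k) = r v * (- q v * k) + s v * (p v * k)] (mod int l ^ v)"
      by (intro cong_add cong_mult cong_refl cong_minus_minus_iff[THEN iffD2] pv) auto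
    also have "r v * (- q v * k) + s v * (p v * k) = k * D v" unfolding D_def by algebra
    also have "[k * D v = k * D (Suc v)] (mod int l ^ v)"
      using Dcoh by (intro cong_mult cong_refl) (auto simp: coherent_def intro: cong_sym)
    also have "[k * D (Suc v) = 0] (mod int l ^ v)"
      using v(1) by (auto simp: cong_0_iff D_def)
    finally show "int l ^ v dvd r v * (- Q * k) + s v * (P * k)" by (simp add: cong_0_iff)
  qed
  have f_eq: "f k = f k' \<longleftrightarrow> [k = k'] (mod int l ^ v)" for k k'
  proof
    assume "f k = f k'"
    then have 1: "[- Q * k = - Q * k'] (mod int l ^ v)" and 2: "[P * k = P * k'] (mod int l ^ v)"
      by (simp_all add: f_def tors_pt_eq_iff[OF l0])
    obtain e g where "int l ^ v dvd e * P + g * Q - 1"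
      using unimodular_bezout[OF l uni[of "Suc v"]] unfolding P_def Q_def by auto
    then show "[k = k'] (mod int l ^ v)" using 1 2 by (rule unimodular_cancel)
  next
    assume "[k = k'] (mod int l ^ v)"
    then show "f k = f k'"
      unfolding f_def tors_pt_eq_iff[OF l0] by (intro conjI cong_mult cong_refl)
  qed
  have surj: "\<exists>k. x = f k" if "x \<in> K" for x
  proof -
    \<comment> \<open>Level at least \<open>Suc v\<close>, so that \<open>D n\<close> has the same
      exact power of \<open>l\<close> as \<open>D (Suc v)\<close>.\<close>
    obtain n u w where n: "n \<ge> Suc v" and x: "x = tors_pt l n u w"
      using torsE[OF _ l0] K \<open>x \<in> K\<close> by (metis subsetD)
    have "n \<ge> 1" using n by simp
    obtain e g where eg: "int l ^ n dvd e * p n + g * q n - 1"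
      using unimodular_bezout[OF l uni[OF \<open>n \<ge> 1\<close>]] by blast
    define k where "k = e * w - g * u"
    have "int l ^ n dvd p n * u + q n * w" "int l ^ n dvd r n * u + s n * w"
      using that Kt unfolding x by auto
    note k = unimodular_row_solutions[OF eg this, folded k_def D_def[THEN fun_cong]]
    have v': "int l ^ v dvd D (Suc v)" "\<not> int l ^ Suc v dvd D (Suc v)"
      using v by (simp_all add: D_def)
    have c: "[D n = D (Suc v)] (mod int l ^ Suc v)" by (rule coherent_cong[OF Dcoh n])
    then have "[D n = D (Suc v)] (mod int l ^ v)" by (rule cong_dvd_modulus) simp
    then have Dn: "int l ^ v dvd D n" using v'(1) by (simp add: cong_dvd_iff)
    have nDn: "\<not> int l ^ Suc v dvd D n" using v'(2) cong_dvd_iff[OF c] by blast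
    obtain j where j: "n = j + v" using n by (metis le_add_diff_inverse2 Suc_leD)
    obtain D' where D': "D n = int l ^ v * D'" using Dn by blast
    have "\<not> int l dvd D'" using nDn D' by auto
    then have cop: "coprime (int l ^ j) D'"
      using l by (metis coprime_power_left_iff prime_imp_coprime prime_nat_int_transfer)
    have "D n * k = int l ^ v * (D' * k)" using D' by simp
    moreover have "int l ^ n = int l ^ v * int l ^ j" by (simp add: j power_add)
    ultimately have "int l ^ v * int l ^ j dvd int l ^ v * (D' * k)" using k(3) by metis
    then have "int l ^ j dvd D' * k" using l0 by simp
    then have "int l ^ j dvd k" using cop coprime_dvd_mult_right_iff by blast
    then obtain k' where k': "k = int l ^ j * k'" by blast
    have "x = tors_pt l n (int l ^ j * (- q n * k')) (int l ^ j * (p n * k'))"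
      using k(1,2) unfolding x k' by (simp add: tors_pt_eq_iff[OF l0] algebra_simps)
    also have "\<dots> = tors_pt l v (- q n * k') (p n * k')"
      unfolding j by (rule tors_pt_scale[OF l0])
    also have "\<dots> = f k'"
      unfolding f_def tors_pt_eq_iff[OF l0] using n
      by (intro conjI cong_mult cong_refl cong_minus_minus_iff[THEN iffD2] cong_sym[OF pv(1)] cong_sym[OF pv(2)]) auto
    finally show ?thesis by blast
  qed
  have car: "carrier (integer_mod_group (l ^ v)) = {0..<int l ^ v}"
    using l0 by (simp add: carrier_integer_mod_group)
  have f_mod: "f (k mod int l ^ v) = f k" for k by (simp add: f_eq)
  have "f \<in> iso (integer_mod_group (l ^ v)) (tors_group K)"
  proof (rule isoI)
    show "f \<in> hom (integer_mod_group (l ^ v)) (tors_group K)"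
    proof (rule homI)
      show "f x \<in> carrier (tors_group K)" for x by (simp add: tors_group_def in_K)
      show "f (x \<otimes>\<^bsub>integer_mod_group (l ^ v)\<^esub> y) = f x \<otimes>\<^bsub>tors_group K\<^esub> f y" for x y
        using f_mod by (simp add: tors_group_def f_def tors_pt_add algebra_simps)
    qed
    show "bij_betw f (carrier (integer_mod_group (l ^ v))) (carrier (tors_group K))"
      unfolding bij_betw_def
    proof
      show "inj_on f (carrier (integer_mod_group (l ^ v)))"
        unfolding car by (intro inj_onI) (auto simp: f_eq cong_def)
      show "f ` carrier (integer_mod_group (l ^ v)) = carrier (tors_group K)"
      proof
        show "f ` carrier (integer_mod_group (l ^ v)) \<subseteq> carrier (tors_group K)"
          using in_K by (auto simp: tors_group_def)
        show "carrier (tors_group K) \<subseteq> f ` carrier (integer_mod_group (l ^ v))"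
        proof
          fix x assume "x \<in> carrier (tors_group K)"
          then have "x \<in> K" by (simp add: tors_group_def)
          then obtain k where "x = f k" using surj by blast
          then have "x = f (k mod int l ^ v)" by (simp add: f_mod)
          moreover have "k mod int l ^ v \<in> carrier (integer_mod_group (l ^ v))"
            unfolding car using l0 by simp
          ultimately show "x \<in> f ` carrier (integer_mod_group (l ^ v))" by blast
        qed
      qed
    qed
  qed
  then show ?thesis by (rule is_isoI)
qed

text \<open>If the determinant is zero l-adically, every multiple of \<open>(-q,p)\<close> lies in
  the kernel, which gives \<open>l^n\<close> points at each level \<open>n\<close>. This excludes
  the elements for which \<open>M - I\<close> is singular.\<close>

lemma tors_kernel_infinite:
  fixes p q r s :: "nat \<Rightarrow> int"
  assumes l: "prime l"
    and Kt: "\<And>n u w. tors_pt l n u w \<in> K \<longleftrightarrow> int l ^ n dvd p n * u + q n * w \<and> int l ^ n dvd r n * u + s n * w"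
    and coh: "coherent l p" "coherent l q"
    and pq: "\<not> (int l dvd p 1 \<and> int l dvd q 1)"
    and det: "\<And>n. int l ^ n dvd p n * s n - q n * r n"
  shows "infinite K"
proof
  assume fin: "finite K"
  have l1: "l > 1" using l prime_gt_1_nat by simp
  then have l0: "l > 0" by simp
  have "l ^ n \<le> card K" if n: "n \<ge> 1" for n
  proof -
    define f where "f = (\<lambda>k. tors_pt l n (- q n * k) (p n * k))"
    have uni: "\<not> (int l dvd p n \<and> int l dvd q n)"
      using pq coherent_cong[OF coh(1) n] coherent_cong[OF coh(2) n] by (auto simp: cong_dvd_iff)
    have "f k \<in> K" for k
    proof -
      have "r n * (- q n * k) + s n * (p n * k) = (p n * s n - q n * r n) * k" by algebra
      then show ?thesis unfolding f_def Kt using det[of n] by (simp add: dvd_mult2)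
    qed
    then have "f ` {0..<int l ^ n} \<subseteq> K" by blast
    moreover have "inj_on f {0..<int l ^ n}"
    proof (rule inj_onI)
      fix k k' assume k: "k \<in> {0..<int l ^ n}" "k' \<in> {0..<int l ^ n}" "f k = f k'"
      then have 1: "[- q n * k = - q n * k'] (mod int l ^ n)" and 2: "[p n * k = p n * k'] (mod int l ^ n)"
        by (simp_all add: f_def tors_pt_eq_iff[OF l0])
      obtain e g where eg: "int l ^ n dvd e * p n + g * q n - 1"
        using unimodular_bezout[OF l uni] by blast
      have "[k = k'] (mod int l ^ n)" using eg 1 2 by (rule unimodular_cancel)
      then show "k = k'" using k by (simp add: cong_def)
    qed
    ultimately have "card {0..<int l ^ n} \<le> card K" using fin by (intro card_inj_on_le)
    then show ?thesis by (simp add: nat_power_eq)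
  qed
  from this[of "Suc (card K)"] have "l ^ Suc (card K) \<le> card K" by simp
  moreover have "Suc (card K) < l ^ Suc (card K)" using l1 by (intro power_gt_expt) simp
  ultimately show False by simp
qed

text \<open>Comparing orders gives \<open>v = 2 a + b\<close>, and comparing exponents gives
  \<open>v \<le> a + b\<close>; together these force \<open>a = 0\<close>.\<close>

lemma cyclic_iso_DirProd_iff:
  assumes l: "prime l"
  shows "integer_mod_group (l ^ v) \<cong> integer_mod_group (l ^ a) \<times>\<times> integer_mod_group (l ^ (a + b))
    \<longleftrightarrow> a = 0 \<and> v = b" (is "?Z \<cong> ?H \<longleftrightarrow> _")
proof
  have l1: "l > 1" using l prime_gt_1_nat by simp
  have Hgrp: "group ?H" by (intro DirProd_group) auto
  have pw: "x [^]\<^bsub>?H\<^esub> m = (fst x [^]\<^bsub>integer_mod_group (l ^ a)\<^esub> m, snd x [^]\<^bsub>integer_mod_group (l ^ (a + b))\<^esub> m)"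
    for x and m :: nat
    by (induction m) (simp_all add: nat_pow_def mult_DirProd' del: mult_integer_mod_group)
  {
    assume iso: "?Z \<cong> ?H"
    have "card (carrier ?Z) = card (carrier ?H)" by (rule iso_same_card[OF iso])
    then have "l ^ v = l ^ (a + (a + b))" using l1
      by (simp add: carrier_integer_mod_group card_cartesian_product nat_power_eq power_add nat_mult_distrib)
    then have v: "v = a + (a + b)" using l1 power_inject_exp by blast
    obtain f where f: "f \<in> iso ?Z ?H" using iso by (auto simp: is_iso_def)
    have "v \<le> a + b"
    proof (cases "v = 0")
      case False
      \<comment> \<open>This power kills the product, being a multiple of the orders of both
        factors; applied to the generator 1 of the cyclic group it bounds \<open>v\<close>.\<close>
      define e where "e = l ^ (a + b)"
      have one: "1 \<in> carrier ?Z" using False l1 by simp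
      have fh: "f \<in> hom ?Z ?H" and inj: "inj_on f (carrier ?Z)"
        using f by (auto simp: iso_def bij_betw_def)
      have "f (1 [^]\<^bsub>?Z\<^esub> e) = f 1 [^]\<^bsub>?H\<^esub> e"
        using hom_nat_pow[OF fh one] Hgrp by simp
      also have "\<dots> = \<one>\<^bsub>?H\<^esub>"
        unfolding pw e_def by (simp add: power_add mult.assoc flip: dvd_eq_mod_eq_0)
      also have "\<dots> = f \<one>\<^bsub>?Z\<^esub>" using hom_one[OF fh] Hgrp by simp
      finally have "1 [^]\<^bsub>?Z\<^esub> e = \<one>\<^bsub>?Z\<^esub>"
        using inj one by (meson inj_onD group.is_monoid group_integer_mod_group monoid.nat_pow_closed monoid.one_closed)
      then have "int l ^ v dvd int l ^ (a + b)" by (simp add: e_def dvd_eq_mod_eq_0)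
      then show ?thesis using l1 by (metis of_nat_dvd_iff of_nat_power power_dvd_imp_le)
    qed simp
    then show "a = 0 \<and> v = b" using v by simp
  }
  {
    assume ab: "a = 0 \<and> v = b"
    have "(\<lambda>k. (0,k)) \<in> iso ?Z ?H"
      using ab by (auto simp: iso_def hom_def bij_betw_def inj_on_def carrier_integer_mod_group image_iff)
    then show "?Z \<cong> ?H" by (rule is_isoI)
  }
qed

text \<open>A unit entry of \<open>M - I\<close> makes one of its two rows unimodular. Exchanging
  the rows keeps the kernel and only changes the sign of the determinant, so both cases reduce to
  the same description of the kernel. A zero determinant is impossible when the kernel is isomorphic
  to a finite product.\<close>

lemma kerMI_iso_iff:
  fixes a b c d :: "nat \<Rightarrow> int"
  assumes l: "prime l" and M: "M = (\<lambda>n. (a n, b n, c n, d n))" "M \<in> Zl_mat l"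
    and nI: "\<not> (int l dvd a 1 - 1 \<and> int l dvd b 1 \<and> int l dvd c 1 \<and> int l dvd d 1 - 1)"
  shows "tors_group (kerMI l M) \<cong> integer_mod_group (l ^ i) \<times>\<times> integer_mod_group (l ^ (i + j)) \<longleftrightarrow>
    i = 0 \<and> int l ^ j dvd (a (Suc j) - 1) * (d (Suc j) - 1) - b (Suc j) * c (Suc j)
      \<and> \<not> int l ^ Suc j dvd (a (Suc j) - 1) * (d (Suc j) - 1) - b (Suc j) * c (Suc j)"
proof -
  have l1: "l > 1" and l0: "l > 0" using l prime_gt_1_nat by (auto simp: prime_gt_0_nat)
  define D where "D = (\<lambda>n. (a n - 1) * (d n - 1) - b n * c n)"
  define K where "K = kerMI l M"
  let ?H = "integer_mod_group (l ^ i) \<times>\<times> integer_mod_group (l ^ (i + j))"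
  have "a \<in> Zl l" "b \<in> Zl l" "c \<in> Zl l" "d \<in> Zl l"
    using M Zl_mat_iff[OF l0] by simp_all
  then have coh: "coherent l (\<lambda>n. a n - 1)" "coherent l b" "coherent l c" "coherent l (\<lambda>n. d n - 1)"
    by (simp_all add: coherent_diff coherent_const Zl_coherent)
  have Dcoh: "coherent l D" unfolding D_def by (intro coherent_diff coherent_mult coh)
  have K: "K \<subseteq> tors l" by (auto simp: K_def kerMI_def)
  have Kt: "tors_pt l n u w \<in> K \<longleftrightarrow> int l ^ n dvd (a n - 1) * u + b n * w \<and> int l ^ n dvd c n * u + (d n - 1) * w"
    for n u w unfolding K_def by (rule kerMI_tors_pt[OF l0 M])
  then have Kt': "tors_pt l n u w \<in> K \<longleftrightarrow> int l ^ n dvd c n * u + (d n - 1) * w \<and> int l ^ n dvd (a n - 1) * u + b n * w"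
    for n u w by blast
  have Dneg: "c n * b n - (d n - 1) * (a n - 1) = - D n" for n by (simp add: D_def mult.commute)
  have rows: "\<not> (int l dvd a 1 - 1 \<and> int l dvd b 1) \<or> \<not> (int l dvd c 1 \<and> int l dvd d 1 - 1)"
    using nI by blast
  have cyc: "integer_mod_group (l ^ v) \<cong> tors_group K"
    if "int l ^ v dvd D (Suc v)" "\<not> int l ^ Suc v dvd D (Suc v)" for v
    using rows
  proof
    assume "\<not> (int l dvd a 1 - 1 \<and> int l dvd b 1)"
    then show ?thesis using that tors_group_cyclic[OF l K Kt coh] by (simp add: D_def)
  next
    assume "\<not> (int l dvd c 1 \<and> int l dvd d 1 - 1)"
    then show ?thesis using that tors_group_cyclic[OF l K Kt' coh(3,4,1,2), of v] by (simp add: Dneg)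
  qed
  have inf: "infinite K" if "\<And>n. int l ^ n dvd D n"
    using rows
  proof
    assume "\<not> (int l dvd a 1 - 1 \<and> int l dvd b 1)"
    then show ?thesis using that tors_kernel_infinite[OF l Kt coh(1,2)] by (simp add: D_def)
  next
    assume "\<not> (int l dvd c 1 \<and> int l dvd d 1 - 1)"
    then show ?thesis using that tors_kernel_infinite[OF l Kt' coh(3,4)] by (simp add: Dneg)
  qed
  show ?thesis
    unfolding D_def[THEN fun_cong, symmetric] K_def[symmetric]
  proof
    assume iso: "tors_group K \<cong> ?H"
    have "finite (carrier ?H)" using l0 by (simp add: carrier_integer_mod_group)
    then have "finite K" using iso
      by (auto simp: is_iso_def iso_def tors_group_def dest: bij_betw_finite)
    then have ex: "\<exists>n. \<not> int l ^ n dvd D n" using inf by blast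
    \<comment> \<open>\<open>n\<close> is positive because \<open>l^0\<close> divides everything;
      its predecessor is the valuation of the determinant.\<close>
    define n where "n = (LEAST n. \<not> int l ^ n dvd D n)"
    have n: "\<not> int l ^ n dvd D n" unfolding n_def using ex by (rule LeastI_ex)
    then obtain v where v: "n = Suc v" by (cases n) auto
    have "int l ^ v dvd D v"
      using not_less_Least[of v "\<lambda>n. \<not> int l ^ n dvd D n"] v n_def by fastforce
    moreover have "[D (Suc v) = D v] (mod int l ^ v)" using Dcoh by (simp add: coherent_def)
    ultimately have "int l ^ v dvd D (Suc v)" by (simp add: cong_dvd_iff)
    then have "integer_mod_group (l ^ v) \<cong> ?H"
      using cyc[of v] n v iso iso_trans by blast
    then have "i = 0 \<and> v = j" using cyclic_iso_DirProd_iff[OF l] by blast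
    then show "i = 0 \<and> int l ^ j dvd D (Suc j) \<and> \<not> int l ^ Suc j dvd D (Suc j)"
      using \<open>int l ^ v dvd D (Suc v)\<close> n v by blast
  next
    assume h: "i = 0 \<and> int l ^ j dvd D (Suc j) \<and> \<not> int l ^ Suc j dvd D (Suc j)"
    then have "tors_group K \<cong> integer_mod_group (l ^ j)"
      using cyc[of j] group.iso_sym[OF group_integer_mod_group] by blast
    also have "integer_mod_group (l ^ j) \<cong> ?H" using cyclic_iso_DirProd_iff[OF l] h by blast
    finally show "tors_group K \<cong> ?H" .
  qed
qed

section \<open>The group of invertible matrices\<close>

lemma mat_mod_mult_left: "mat_mod m (mat_mul (mat_mod m A) B) = mat_mod m (mat_mul A B)"
  and mat_mod_mult_right: "mat_mod m (mat_mul A (mat_mod m B)) = mat_mod m (mat_mul A B)"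
  by (cases A; cases B;
      simp only: mat_mod.simps mat_mul.simps prod.inject cong_def[symmetric];
      intro conjI cong_add cong_mult cong_refl; simp)+

lemma mat_mul_assoc: "mat_mul (mat_mul A B) C = mat_mul A (mat_mul B C)"
  by (cases A; cases B; cases C) (simp add: algebra_simps)

lemma mat_det_mul: "mat_det (mat_mul A B) = mat_det A * mat_det B"
  by (cases A; cases B) (simp add: algebra_simps)

lemma mat_det_mod: "[mat_det (mat_mod m A) = mat_det A] (mod m)"
  by (cases A) (auto intro!: cong_diff cong_mult)

lemma mat_mod_mod:
  assumes "k dvd m"
  shows "mat_mod k (mat_mod m A) = mat_mod k A"
  using assms by (cases A) (simp add: mod_mod_cancel)

lemma mat_mod_eq_iff:
  "mat_mod m (a,b,c,d) = mat_mod m (a',b',c',d') \<longleftrightarrow>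
    [a = a'] (mod m) \<and> [b = b'] (mod m) \<and> [c = c'] (mod m) \<and> [d = d'] (mod m)"
  by (simp only: mat_mod.simps prod.inject cong_def)

lemma mat_mul_one [simp]: "mat_mul (1,0,0,1) A = A" "mat_mul A (1,0,0,1) = A"
  by (cases A; simp)+

lemma Zl_mat_iff_Suc: "M \<in> Zl_mat l \<longleftrightarrow> (\<forall>n. mat_mod (int l ^ n) (M (Suc n)) = M n)"
proof -
  have "M n = mat_mod (int l ^ n) (M n)" if "mat_mod (int l ^ n) (M (Suc n)) = M n" for n
    unfolding that[symmetric] by (simp add: mat_mod_mod)
  then show ?thesis unfolding Zl_mat_def by blast
qed

lemma Zl_mat_mod:
  assumes "M \<in> Zl_mat l" "k \<le> n"
  shows "mat_mod (int l ^ k) (M n) = M k"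
  using assms(2)
proof (induction n rule: dec_induct)
  case base
  show ?case using assms(1) by (simp add: Zl_mat_def)
next
  case (step n)
  have "mat_mod (int l ^ k) (M (Suc n)) = mat_mod (int l ^ k) (mat_mod (int l ^ n) (M (Suc n)))"
    using step.hyps by (simp add: mat_mod_mod le_imp_power_dvd)
  then show ?case using step.IH assms(1) by (simp add: Zl_mat_iff_Suc)
qed

lemma lmat_mul_Zl:
  assumes "M \<in> Zl_mat l" "N \<in> Zl_mat l"
  shows "lmat_mul l M N \<in> Zl_mat l"
  unfolding Zl_mat_iff_Suc lmat_mul_def
proof
  fix n
  have MN: "M n = mat_mod (int l ^ n) (M (Suc n))" "N n = mat_mod (int l ^ n) (N (Suc n))"
    using assms by (simp_all add: Zl_mat_iff_Suc)
  show "mat_mod (int l ^ n) (mat_mod (int l ^ Suc n) (mat_mul (M (Suc n)) (N (Suc n))))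
      = mat_mod (int l ^ n) (mat_mul (M n) (N n))"
    unfolding MN mat_mod_mult_left mat_mod_mult_right by (rule mat_mod_mod) simp
qed

lemma lmat_mul_assoc: "lmat_mul l (lmat_mul l M N) P = lmat_mul l M (lmat_mul l N P)"
  by (simp add: lmat_mul_def mat_mod_mult_left mat_mod_mult_right mat_mul_assoc)

definition lmat_one :: "nat \<Rightarrow> lmat" where
  "lmat_one l = (\<lambda>n. mat_mod (int l ^ n) (1,0,0,1))"

lemma lmat_one_Zl: "lmat_one l \<in> Zl_mat l"
  unfolding Zl_mat_iff_Suc lmat_one_def by (intro allI mat_mod_mod) simp

lemma lmat_mul_one:
  assumes "M \<in> Zl_mat l"
  shows "lmat_mul l (lmat_one l) M = M" "lmat_mul l M (lmat_one l) = M"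
  using Zl_mat_mod[OF assms order_refl]
  by (simp_all only: lmat_mul_def lmat_one_def mat_mod_mult_left mat_mod_mult_right mat_mul_one)

text \<open>This packaging gives access to inverses and their laws, while \<open>conj_set\<close>
  and \<open>normalizer\<close> are phrased without inverses.\<close>

definition GL2_group :: "nat \<Rightarrow> lmat monoid" where
  "GL2_group l = \<lparr>carrier = GL2 l, monoid.mult = lmat_mul l, one = lmat_one l\<rparr>"

lemma GL2_Zl: "M \<in> GL2 l \<Longrightarrow> M \<in> Zl_mat l"
  by (simp add: GL2_def)

lemma GL2_det_coprime:
  assumes l: "prime l" and M: "M \<in> GL2 l"
  shows "coprime (mat_det (M n)) (int l ^ n)"
proof (cases "n = 0")
  case False
  then have "M 1 = mat_mod (int l) (M n)"
    using Zl_mat_mod[OF GL2_Zl[OF M], of 1 n] by simp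
  then have "[mat_det (M 1) = mat_det (M n)] (mod int l)" by (metis mat_det_mod)
  then have "\<not> int l dvd mat_det (M n)" using M cong_dvd_iff by (auto simp: GL2_def)
  then have "coprime (mat_det (M n)) (int l)"
    using l by (metis coprime_commute prime_imp_coprime prime_nat_int_transfer)
  then show ?thesis by simp
qed simp

fun mat_adj :: "imat \<Rightarrow> imat" where
  "mat_adj (a,b,c,d) = (d, - b, - c, a)"

fun mat_smult :: "int \<Rightarrow> imat \<Rightarrow> imat" where
  "mat_smult k (a,b,c,d) = (k * a, k * b, k * c, k * d)"

lemma mat_adj_mul: "mat_mul (mat_smult k (mat_adj A)) A = (mat_det A * k, 0, 0, mat_det A * k)"
  by (cases A) (simp add: algebra_simps)

lemma mat_det_smult_adj: "mat_det (mat_smult k (mat_adj A)) = k * (k * mat_det A)"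
  by (cases A) (simp add: algebra_simps)

text \<open>At each level the inverse is the adjugate divided by the determinant. The inverses
  \<open>e n\<close> of the determinant are chosen independently, but they cohere because an inverse
  modulo \<open>l^n\<close> is unique.\<close>

lemma GL2_left_inverse:
  assumes l: "prime l" and M: "M \<in> GL2 l"
  shows "\<exists>N\<in>GL2 l. lmat_mul l N M = lmat_one l"
proof -
  have "\<exists>e. [mat_det (M n) * e = 1] (mod int l ^ n)" for n
    using GL2_det_coprime[OF assms] cong_solve_coprime_int by blast
  then obtain e where e: "\<And>n. [mat_det (M n) * e n = 1] (mod int l ^ n)" by metis
  define N where "N = (\<lambda>n. mat_mod (int l ^ n) (mat_smult (e n) (mat_adj (M n))))"
  have Mmod: "M n = mat_mod (int l ^ n) (M (Suc n))" for n
    using GL2_Zl[OF M] by (simp add: Zl_mat_iff_Suc)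
  have "[e (Suc n) = e n] (mod int l ^ n)" for n
  proof -
    have d: "[mat_det (M (Suc n)) = mat_det (M n)] (mod int l ^ n)"
      by (metis Mmod mat_det_mod cong_sym)
    have "[mat_det (M (Suc n)) * e (Suc n) = 1] (mod int l ^ n)"
      using e[of "Suc n"] by (rule cong_dvd_modulus) simp
    then have "[mat_det (M n) * e (Suc n) = 1] (mod int l ^ n)"
      using d by (meson cong_mult cong_refl cong_sym cong_trans)
    then have "[mat_det (M n) * e (Suc n) = mat_det (M n) * e n] (mod int l ^ n)"
      using e[of n] by (meson cong_sym cong_trans)
    then show ?thesis using GL2_det_coprime[OF assms] cong_mult_lcancel by blast
  qed note ecoh = this
  have "N \<in> Zl_mat l"
    unfolding Zl_mat_iff_Suc
  proof
    fix n
    obtain a b c d where A: "M (Suc n) = (a,b,c,d)" by (metis prod_cases4)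
    have An: "M n = (a mod int l ^ n, b mod int l ^ n, c mod int l ^ n, d mod int l ^ n)"
      using Mmod[of n] by (simp add: A)
    have "mat_mod (int l ^ n) (mat_smult (e (Suc n)) (mat_adj (M (Suc n))))
        = mat_mod (int l ^ n) (mat_smult (e n) (mat_adj (M n)))"
      unfolding A An mat_adj.simps mat_smult.simps mat_mod_eq_iff
      by (intro conjI cong_mult ecoh cong_minus_minus_iff[THEN iffD2]) (simp_all add: cong_def)
    then show "mat_mod (int l ^ n) (N (Suc n)) = N n"
      unfolding N_def by (simp add: mat_mod_mod)
  qed
  moreover have "\<not> int l dvd mat_det (N 1)"
  proof
    assume "int l dvd mat_det (N 1)"
    moreover have "[mat_det (N 1) = mat_det (mat_smult (e 1) (mat_adj (M 1)))] (mod int l)"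
      using mat_det_mod[of "int l"] by (simp add: N_def)
    ultimately have "int l dvd e 1 * (e 1 * mat_det (M 1))"
      unfolding mat_det_smult_adj by (simp add: cong_dvd_iff)
    then have "int l dvd e 1 * mat_det (M 1)"
      using l by (metis dvd_mult2 prime_dvd_mult_iff prime_nat_int_transfer)
    moreover have "[mat_det (M 1) * e 1 = 1] (mod int l)" using e[of 1] by simp
    ultimately have "int l dvd 1" by (metis cong_dvd_iff mult.commute)
    then show False using prime_gt_1_nat[OF l] by simp
  qed
  ultimately have "N \<in> GL2 l" by (simp add: GL2_def)
  moreover have "lmat_mul l N M = lmat_one l"
  proof
    fix n
    show "lmat_mul l N M n = lmat_one l n"
      using e[of n] unfolding lmat_mul_def lmat_one_def N_def mat_mod_mult_left mat_adj_mul mat_mod_eq_iff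
      by simp
  qed
  ultimately show ?thesis by blast
qed

lemma lmat_mul_GL2:
  assumes l: "prime l" and "M \<in> GL2 l" "N \<in> GL2 l"
  shows "lmat_mul l M N \<in> GL2 l"
proof -
  have e: "lmat_mul l M N 1 = mat_mod (int l) (mat_mul (M 1) (N 1))" by (simp add: lmat_mul_def)
  have "int l dvd mat_det (lmat_mul l M N 1) \<longleftrightarrow> int l dvd mat_det (M 1) * mat_det (N 1)"
    unfolding e mat_det_mul[symmetric] by (rule cong_dvd_iff[OF mat_det_mod])
  moreover have "\<not> int l dvd mat_det (M 1) * mat_det (N 1)"
    using assms by (auto simp: GL2_def prime_dvd_mult_iff)
  ultimately have "\<not> int l dvd mat_det (lmat_mul l M N 1)" by blast
  then show ?thesis using assms lmat_mul_Zl by (simp add: GL2_def)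
qed

lemma lmat_one_GL2: "prime l \<Longrightarrow> lmat_one l \<in> GL2 l"
  using lmat_one_Zl prime_gt_1_nat[of l] by (simp add: GL2_def lmat_one_def)

lemma group_GL2:
  assumes l: "prime l"
  shows "group (GL2_group l)"
proof -
  have car: "carrier (GL2_group l) = GL2 l" and mul: "monoid.mult (GL2_group l) = lmat_mul l"
    and one: "one (GL2_group l) = lmat_one l"
    by (simp_all add: GL2_group_def)
  show ?thesis
  proof (rule groupI; unfold car mul one)
    show "lmat_mul l x y \<in> GL2 l" if "x \<in> GL2 l" "y \<in> GL2 l" for x y
      by (rule lmat_mul_GL2[OF l that])
    show "lmat_one l \<in> GL2 l" by (rule lmat_one_GL2[OF l])
    show "lmat_mul l (lmat_mul l x y) z = lmat_mul l x (lmat_mul l y z)" for x y z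
      by (rule lmat_mul_assoc)
    show "lmat_mul l (lmat_one l) x = x" if "x \<in> GL2 l" for x
      by (rule lmat_mul_one(1)[OF GL2_Zl[OF that]])
    show "\<exists>y\<in>GL2 l. lmat_mul l y x = lmat_one l" if "x \<in> GL2 l" for x
      by (rule GL2_left_inverse[OF l that])
  qed
qed

text \<open>The explicit map \<open>g X g^(-1)\<close> behind the inverse-free relation
  \<open>M g = g X\<close> of \<open>conj_set\<close>.\<close>

definition lmat_conj :: "nat \<Rightarrow> lmat \<Rightarrow> lmat \<Rightarrow> lmat" where
  "lmat_conj l g X = lmat_mul l (lmat_mul l g X) (inv\<^bsub>GL2_group l\<^esub> g)"

context
  fixes l :: nat
  assumes l: "prime l"
begin

interpretation GL: group "GL2_group l"
  by (rule group_GL2[OF l])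

lemma carrier_GL2_group: "carrier (GL2_group l) = GL2 l"
  and mult_GL2_group: "x \<otimes>\<^bsub>GL2_group l\<^esub> y = lmat_mul l x y"
  and one_GL2_group: "\<one>\<^bsub>GL2_group l\<^esub> = lmat_one l"
  by (simp_all add: GL2_group_def)

lemma inv_GL2: "g \<in> GL2 l \<Longrightarrow> inv\<^bsub>GL2_group l\<^esub> g \<in> GL2 l"
  using GL.inv_closed by (simp add: carrier_GL2_group)

lemma lmat_conj_GL2: "g \<in> GL2 l \<Longrightarrow> X \<in> GL2 l \<Longrightarrow> lmat_conj l g X \<in> GL2 l"
  by (simp add: lmat_conj_def lmat_mul_GL2[OF l] inv_GL2)

lemma lmat_conj_lmat_conj:
  assumes "g \<in> GL2 l" "h \<in> GL2 l" "X \<in> GL2 l"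
  shows "lmat_conj l h (lmat_conj l g X) = lmat_conj l (lmat_mul l h g) X"
  using assms GL.inv_mult_group[of h g]
  by (simp add: lmat_conj_def lmat_mul_assoc carrier_GL2_group mult_GL2_group)

lemma lmat_conj_one: "X \<in> GL2 l \<Longrightarrow> lmat_conj l (lmat_one l) X = X"
  using GL.inv_one by (simp add: lmat_conj_def one_GL2_group lmat_mul_one GL2_Zl)

lemma lmat_conj_inv:
  assumes "g \<in> GL2 l" "X \<in> GL2 l"
  shows "lmat_conj l (inv\<^bsub>GL2_group l\<^esub> g) (lmat_conj l g X) = X" "lmat_conj l g (lmat_conj l (inv\<^bsub>GL2_group l\<^esub> g) X) = X"
  using assms GL.l_inv[of g] GL.r_inv[of g]
  by (simp_all add: lmat_conj_lmat_conj inv_GL2 lmat_conj_one carrier_GL2_group mult_GL2_group one_GL2_group)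

lemma lmat_conj_mult:
  assumes "g \<in> GL2 l" "X \<in> GL2 l"
  shows "lmat_mul l (lmat_conj l g X) g = lmat_mul l g X"
  using assms GL.l_inv[of g]
  by (simp add: lmat_conj_def lmat_mul_assoc carrier_GL2_group mult_GL2_group one_GL2_group
      lmat_mul_one GL2_Zl lmat_mul_Zl)

lemma lmat_conj_eqI:
  assumes "g \<in> GL2 l" "M \<in> Zl_mat l" "lmat_mul l M g = lmat_mul l g X"
  shows "M = lmat_conj l g X"
  using assms GL.r_inv[of g]
  by (simp add: lmat_conj_def carrier_GL2_group mult_GL2_group one_GL2_group lmat_mul_one lmat_mul_assoc
      flip: assms(3))

lemma conj_set_eq:
  assumes "g \<in> GL2 l" "H \<subseteq> GL2 l"
  shows "conj_set l g H = lmat_conj l g ` H"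
proof
  show "conj_set l g H \<subseteq> lmat_conj l g ` H"
    using lmat_conj_eqI[OF assms(1)] by (auto simp: conj_set_def)
  show "lmat_conj l g ` H \<subseteq> conj_set l g H"
    using assms lmat_conj_mult lmat_conj_GL2 GL2_Zl by (fastforce simp: conj_set_def)
qed

text \<open>Transport of structure; it reduces the computation of the normalizer to the Cartan
  subgroup written in the basis \<open>1, \<alpha>\<close>.\<close>

lemma normalizer_conj:
  assumes g: "g \<in> GL2 l" and H: "H \<subseteq> GL2 l"
  shows "normalizer l (conj_set l g H) = conj_set l g (normalizer l H)"
proof -
  let ?i = "inv\<^bsub>GL2_group l\<^esub> g"
  have gi: "?i \<in> GL2 l" by (rule inv_GL2[OF g])
  have gH: "lmat_conj l g ` H \<subseteq> GL2 l" using g H lmat_conj_GL2 by blast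
  have cc: "lmat_conj l h ` lmat_conj l k ` S = lmat_conj l (lmat_mul l h k) ` S" if "h \<in> GL2 l" "k \<in> GL2 l" "S \<subseteq> GL2 l" for h k S
    unfolding image_image using that lmat_conj_lmat_conj by (intro image_cong) auto
  have canc: "lmat_conj l ?i ` lmat_conj l g ` S = S" if "S \<subseteq> GL2 l" for S
  proof -
    have "(\<lambda>x. lmat_conj l ?i (lmat_conj l g x)) ` S = (\<lambda>x. x) ` S"
      using that g lmat_conj_inv(1) by (intro image_cong) auto
    then show ?thesis by (simp add: image_image)
  qed
  have key: "lmat_conj l (lmat_conj l g k) ` lmat_conj l g ` H = lmat_conj l g ` H \<longleftrightarrow> lmat_conj l k ` H = H" if k: "k \<in> GL2 l" for k
  proof -
    have "lmat_conj l (lmat_conj l g k) ` lmat_conj l g ` H = lmat_conj l (lmat_mul l (lmat_conj l g k) g) ` H"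
      using g k H lmat_conj_GL2 by (intro cc) auto
    also have "\<dots> = lmat_conj l g ` lmat_conj l k ` H"
      using g k H lmat_conj_mult cc by simp
    finally have e: "lmat_conj l (lmat_conj l g k) ` lmat_conj l g ` H = lmat_conj l g ` lmat_conj l k ` H" .
    have "lmat_conj l k ` H \<subseteq> GL2 l" using k H lmat_conj_GL2 by blast
    then show ?thesis unfolding e using canc H by metis
  qed
  have NH: "normalizer l H \<subseteq> GL2 l" by (auto simp: normalizer_def)
  have n1: "normalizer l H = {k \<in> GL2 l. lmat_conj l k ` H = H}"
    using H by (auto simp: normalizer_def conj_set_eq)
  have n2: "normalizer l (lmat_conj l g ` H) = {h \<in> GL2 l. lmat_conj l h ` lmat_conj l g ` H = lmat_conj l g ` H}"
    using gH by (auto simp: normalizer_def conj_set_eq)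
  have "normalizer l (lmat_conj l g ` H) = lmat_conj l g ` normalizer l H"
  proof
    show "normalizer l (lmat_conj l g ` H) \<subseteq> lmat_conj l g ` normalizer l H"
    proof
      fix h assume h: "h \<in> normalizer l (lmat_conj l g ` H)"
      then have hG: "h \<in> GL2 l" by (simp add: n2)
      then have e: "h = lmat_conj l g (lmat_conj l ?i h)" using g lmat_conj_inv(2) by simp
      have "lmat_conj l ?i h \<in> normalizer l H"
        using h key[of "lmat_conj l ?i h"] e hG gi lmat_conj_GL2 by (auto simp: n1 n2)
      then show "h \<in> lmat_conj l g ` normalizer l H" using e by blast
    qed
    show "lmat_conj l g ` normalizer l H \<subseteq> normalizer l (lmat_conj l g ` H)"
    proof
      fix h assume "h \<in> lmat_conj l g ` normalizer l H"
      then obtain k where "k \<in> GL2 l" "lmat_conj l k ` H = H" "h = lmat_conj l g k" by (auto simp: n1)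
      then show "h \<in> normalizer l (lmat_conj l g ` H)" using key[of k] g lmat_conj_GL2 by (simp add: n2)
    qed
  qed
  then show ?thesis using conj_set_eq[OF g H] conj_set_eq[OF g NH] by simp
qed

end

section \<open>The normalizer of the Cartan subgroup\<close>

definition cartan_mat :: "int \<Rightarrow> int \<Rightarrow> int \<times> int \<Rightarrow> imat" where
  "cartan_mat t n = (\<lambda>(x,y). (x, - n * y, y, x + t * y))"

text \<open>Matrix of \<open>v \<mapsto> (x + y \<alpha>) v'\<close> in the basis \<open>1, \<alpha>\<close>, where \<open>v \<mapsto> v'\<close> is the conjugation
  \<open>\<alpha> \<mapsto> t - \<alpha>\<close>.\<close>

definition twisted_mat :: "int \<Rightarrow> int \<Rightarrow> int \<times> int \<Rightarrow> imat" where
  "twisted_mat t n = (\<lambda>(x,y). (x, t * x + n * y, y, - x))"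

lemma det_cartan_mat: "mat_det (cartan_mat t n (x,y)) = qform t n x y"
  by (simp add: cartan_mat_def qform_def power2_eq_square algebra_simps)

lemma det_twisted_mat: "mat_det (twisted_mat t n (x,y)) = - qform t n x y"
  by (simp add: twisted_mat_def qform_def power2_eq_square algebra_simps)

lemma cartan_mat_comm:
  "mat_mul (cartan_mat t n (x,y)) (cartan_mat t n (x',y')) = mat_mul (cartan_mat t n (x',y')) (cartan_mat t n (x,y))"
  by (simp add: cartan_mat_def algebra_simps)

text \<open>Semilinearity: moving an element of R across \<open>u \<sigma>\<close> replaces it by
  its conjugate, and \<open>(x + t y) - y \<alpha>\<close> is the conjugate of
  \<open>x + y \<alpha>\<close>.\<close>

lemma twisted_mat_comm:
  "mat_mul (cartan_mat t n (x + t * y, - y)) (twisted_mat t n (x',y'))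
    = mat_mul (twisted_mat t n (x',y')) (cartan_mat t n (x,y))"
  by (simp add: cartan_mat_def twisted_mat_def algebra_simps)

lemma cartan_mat_cong:
  assumes "[t = t'] (mod m)" "[n = n'] (mod m)" "[x = x'] (mod m)" "[y = y'] (mod m)"
  shows "mat_mod m (cartan_mat t n (x,y)) = mat_mod m (cartan_mat t' n' (x',y'))"
  unfolding cartan_mat_def split_conv mat_mod_eq_iff
  using assms cong_minus_minus_iff[of n n' m] cong_minus_minus_iff[of x x' m]
  by (simp only: cong_add cong_mult simp_thms)

lemma twisted_mat_cong:
  assumes "[t = t'] (mod m)" "[n = n'] (mod m)" "[x = x'] (mod m)" "[y = y'] (mod m)"
  shows "mat_mod m (twisted_mat t n (x,y)) = mat_mod m (twisted_mat t' n' (x',y'))"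
  unfolding twisted_mat_def split_conv mat_mod_eq_iff
  using assms cong_minus_minus_iff[of n n' m] cong_minus_minus_iff[of x x' m]
  by (simp only: cong_add cong_mult simp_thms)

definition twisted :: "nat \<Rightarrow> (nat \<Rightarrow> int) \<Rightarrow> (nat \<Rightarrow> int) \<Rightarrow> lmat set" where
  "twisted l t nn = {M \<in> GL2 l. \<exists>x y. coherent l x \<and> coherent l y \<and>
      (\<forall>k. M k = mat_mod (int l ^ k) (twisted_mat (t k) (nn k) (x k, y k)))}"

text \<open>Allows unreduced coordinates, so that derived ones such as \<open>x + t y\<close> and
  \<open>- y\<close> can be used directly.\<close>

lemma cartan0_iff:
  assumes "l > 0"
  shows "cartan0 l t nn = {M \<in> GL2 l. \<exists>x y. coherent l x \<and> coherent l y \<and>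
      (\<forall>k. M k = mat_mod (int l ^ k) (cartan_mat (t k) (nn k) (x k, y k)))}" (is "_ = ?R")
proof
  show "cartan0 l t nn \<subseteq> ?R"
    unfolding cartan0_def cartan_mat_def split_conv using Zl_coherent by blast
  show "?R \<subseteq> cartan0 l t nn"
  proof
    fix M assume "M \<in> ?R"
    then obtain x y where M: "M \<in> GL2 l" "coherent l x" "coherent l y"
      "\<And>k. M k = mat_mod (int l ^ k) (cartan_mat (t k) (nn k) (x k, y k))" by blast
    define x' y' where "x' = (\<lambda>k. x k mod int l ^ k)" and "y' = (\<lambda>k. y k mod int l ^ k)"
    have "\<forall>k. M k = mat_mod (int l ^ k) (cartan_mat (t k) (nn k) (x' k, y' k))"
    proof
      fix k
      show "M k = mat_mod (int l ^ k) (cartan_mat (t k) (nn k) (x' k, y' k))"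
        unfolding M(4)[of k] x'_def y'_def by (rule cartan_mat_cong) (simp_all add: cong_def)
    qed
    moreover have "x' \<in> Zl l" "y' \<in> Zl l"
      unfolding x'_def y'_def using coherent_mod_Zl M assms by auto
    ultimately show "M \<in> cartan0 l t nn"
      unfolding cartan0_def cartan_mat_def split_conv using M(1) by blast
  qed
qed

lemma coherent_mat_Zl:
  assumes "coherent l a" "coherent l b" "coherent l c" "coherent l d"
    and "\<And>k. M k = mat_mod (int l ^ k) (a k, b k, c k, d k)"
  shows "M \<in> Zl_mat l"
  unfolding Zl_mat_iff_Suc assms(5)
proof
  fix n
  show "mat_mod (int l ^ n) (mat_mod (int l ^ Suc n) (a (Suc n), b (Suc n), c (Suc n), d (Suc n)))
      = mat_mod (int l ^ n) (a n, b n, c n, d n)"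
    using assms(1-4) mat_mod_eq_iff by (subst mat_mod_mod) (simp_all add: coherent_def cong_def)
qed

lemma cartan0I:
  assumes l: "prime l" and t: "coherent l t" and nn: "coherent l nn"
    and xy: "coherent l x" "coherent l y"
    and u: "\<not> int l dvd qform (t 1) (nn 1) (x 1) (y 1)"
  shows "(\<lambda>k. mat_mod (int l ^ k) (cartan_mat (t k) (nn k) (x k, y k))) \<in> cartan0 l t nn"
    (is "?M \<in> _")
proof -
  have "?M \<in> Zl_mat l"
    by (rule coherent_mat_Zl[of _ x "\<lambda>k. - nn k * y k" y "\<lambda>k. x k + t k * y k"])
      (use t nn xy in \<open>auto simp: cartan_mat_def intro: coherent_add coherent_mult coherent_uminus\<close>)
  moreover have "\<not> int l dvd mat_det (?M 1)"
    using u cong_dvd_iff[OF mat_det_mod[of "int l" "cartan_mat (t 1) (nn 1) (x 1, y 1)"]]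
    by (simp add: det_cartan_mat)
  ultimately have "?M \<in> GL2 l" by (simp add: GL2_def)
  then show ?thesis using cartan0_iff[OF prime_gt_0_nat[OF l]] xy by blast
qed

lemma twistedI:
  assumes l: "prime l" and t: "coherent l t" and nn: "coherent l nn"
    and xy: "coherent l x" "coherent l y"
    and u: "\<not> int l dvd qform (t 1) (nn 1) (x 1) (y 1)"
  shows "(\<lambda>k. mat_mod (int l ^ k) (twisted_mat (t k) (nn k) (x k, y k))) \<in> twisted l t nn"
    (is "?M \<in> _")
proof -
  have "?M \<in> Zl_mat l"
    by (rule coherent_mat_Zl[of _ x "\<lambda>k. t k * x k + nn k * y k" y "\<lambda>k. - x k"])
      (use t nn xy in \<open>auto simp: twisted_mat_def intro: coherent_add coherent_mult coherent_uminus\<close>)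
  moreover have "\<not> int l dvd mat_det (?M 1)"
    using u cong_dvd_iff[OF mat_det_mod[of "int l" "twisted_mat (t 1) (nn 1) (x 1, y 1)"]]
    by (simp add: det_twisted_mat)
  ultimately have "?M \<in> GL2 l" by (simp add: GL2_def)
  then show ?thesis using xy by (auto simp: twisted_def)
qed

text \<open>The hypotheses say that \<open>X + Y \<alpha>\<close> is conjugate to \<open>\<alpha>\<close> modulo \<open>m\<close>: the traces agree, and so do
  the discriminants \<open>Y\<^sup>2 (t\<^sup>2 - 4 n)\<close> and \<open>t\<^sup>2 - 4 n\<close>.\<close>

lemma conj_generator:
  fixes m :: int
  assumes "coprime (p * s - q * r) m"
    and e1: "[X * p - n * Y * r = q] (mod m)" and e2: "[X * q - n * Y * s = - n * p + t * q] (mod m)"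
    and e3: "[Y * p + (X + t * Y) * r = s] (mod m)" and e4: "[Y * q + (X + t * Y) * s = - n * r + t * s] (mod m)"
    and D: "coprime (t^2 - 4 * n) m"
  shows "[2 * X + t * Y = t] (mod m)" "[Y^2 = 1] (mod m)"
proof -
  define d where "d = p * s - q * r"
  \<comment> \<open>The four congruences say \<open>A g = g B\<close>, with \<open>A\<close> and
    \<open>B\<close> the matrices of \<open>X + Y \<alpha>\<close> and of \<alpha>. Multiplying by
    the adjugate of \<open>g\<close> and taking traces gives \<open>d\<close> times the trace on
    each side.\<close>
  have "[s * (X * p - n * Y * r) - r * (X * q - n * Y * s)
      + (p * (Y * q + (X + t * Y) * s) - q * (Y * p + (X + t * Y) * r))
      = s * q - r * (- n * p + t * q) + (p * (- n * r + t * s) - q * s)] (mod m)"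
    by (intro cong_add cong_diff cong_mult cong_refl e1 e2 e3 e4)
  moreover have "s * (X * p - n * Y * r) - r * (X * q - n * Y * s)
      + (p * (Y * q + (X + t * Y) * s) - q * (Y * p + (X + t * Y) * r)) = d * (2 * X + t * Y)"
    "s * q - r * (- n * p + t * q) + (p * (- n * r + t * s) - q * s) = d * t"
    unfolding d_def by algebra+
  ultimately have "[d * (2 * X + t * Y) = d * t] (mod m)" by metis
  then show tr: "[2 * X + t * Y = t] (mod m)"
    using assms(1) cong_mult_lcancel unfolding d_def by blast
  \<comment> \<open>Determinants of both sides of \<open>A g = g B\<close>.\<close>
  have "[(X * p - n * Y * r) * (Y * q + (X + t * Y) * s) - (X * q - n * Y * s) * (Y * p + (X + t * Y) * r)
      = q * (- n * r + t * s) - (- n * p + t * q) * s] (mod m)"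
    by (intro cong_diff cong_mult e1 e2 e3 e4)
  moreover have "(X * p - n * Y * r) * (Y * q + (X + t * Y) * s) - (X * q - n * Y * s) * (Y * p + (X + t * Y) * r)
      = d * qform t n X Y"
    "q * (- n * r + t * s) - (- n * p + t * q) * s = d * n"
    unfolding d_def qform_def by algebra+
  ultimately have "[d * qform t n X Y = d * n] (mod m)" by metis
  then have nm: "[qform t n X Y = n] (mod m)"
    using assms(1) cong_mult_lcancel unfolding d_def by blast
  \<comment> \<open>Equality of the discriminants of the two characteristic polynomials.\<close>
  have "[(2 * X + t * Y)^2 - 4 * qform t n X Y = t^2 - 4 * n] (mod m)"
    by (intro cong_diff cong_mult cong_pow cong_refl tr nm)
  moreover have "(2 * X + t * Y)^2 - 4 * qform t n X Y = (t^2 - 4 * n) * Y^2"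
    unfolding qform_def by algebra
  ultimately have "[(t^2 - 4 * n) * Y^2 = (t^2 - 4 * n) * 1] (mod m)" by simp
  then show "[Y^2 = 1] (mod m)"
    using D cong_mult_lcancel by blast
qed

lemma lmat_conj_cartan0:
  assumes l: "prime l" and t: "coherent l t" and nn: "coherent l nn" and h: "h \<in> cartan0 l t nn"
  shows "lmat_conj l h ` cartan0 l t nn = cartan0 l t nn"
proof -
  note iff = cartan0_iff[OF prime_gt_0_nat[OF l]]
  have "lmat_conj l h X = X" if X: "X \<in> cartan0 l t nn" for X
  proof -
    obtain x y where x: "\<And>k. X k = mat_mod (int l ^ k) (cartan_mat (t k) (nn k) (x k, y k))"
      using X iff by blast
    obtain x' y' where x': "\<And>k. h k = mat_mod (int l ^ k) (cartan_mat (t k) (nn k) (x' k, y' k))"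
      using h iff by blast
    have "lmat_mul l X h = lmat_mul l h X"
    proof
      fix k
      show "lmat_mul l X h k = lmat_mul l h X k"
        unfolding lmat_mul_def x x' mat_mod_mult_left mat_mod_mult_right by (subst cartan_mat_comm) simp
    qed
    moreover have "h \<in> GL2 l" "X \<in> Zl_mat l" using h X iff GL2_Zl by blast+
    ultimately show ?thesis using lmat_conj_eqI[OF l] by metis
  qed
  then show ?thesis by simp
qed

text \<open>Conjugation by \<open>h\<close> acts on the Cartan subgroup as the involution \<sigma>;
  being its own inverse there, it yields both inclusions.\<close>

lemma lmat_conj_twisted:
  assumes l: "prime l" and t: "coherent l t" and nn: "coherent l nn" and h: "h \<in> twisted l t nn"
  shows "lmat_conj l h ` cartan0 l t nn = cartan0 l t nn"
proof -
  note iff = cartan0_iff[OF prime_gt_0_nat[OF l]]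
  have hG: "h \<in> GL2 l" using h by (simp add: twisted_def)
  obtain x' y' where x': "\<And>k. h k = mat_mod (int l ^ k) (twisted_mat (t k) (nn k) (x' k, y' k))"
    using h unfolding twisted_def by blast
  have *: "\<exists>Y\<in>cartan0 l t nn. lmat_conj l h X = Y \<and> lmat_conj l h Y = X" if X: "X \<in> cartan0 l t nn" for X
  proof -
    obtain x y where xy: "coherent l x" "coherent l y"
      and x: "\<And>k. X k = mat_mod (int l ^ k) (cartan_mat (t k) (nn k) (x k, y k))"
      using X iff by blast
    define Y where "Y = (\<lambda>k. mat_mod (int l ^ k) (cartan_mat (t k) (nn k) (x k + t k * y k, - y k)))"
    have XZ: "X \<in> Zl_mat l" and nd: "\<not> int l dvd mat_det (X 1)"
      using X iff by (auto simp: GL2_def)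
    have "\<not> int l dvd qform (t 1) (nn 1) (x 1) (y 1)"
      using nd cong_dvd_iff[OF mat_det_mod[of "int l" "cartan_mat (t 1) (nn 1) (x 1, y 1)"]]
      by (simp add: det_cartan_mat x)
    moreover have "qform (t 1) (nn 1) (x 1 + t 1 * y 1) (- y 1) = qform (t 1) (nn 1) (x 1) (y 1)"
      unfolding qform_def by algebra
    ultimately have Y: "Y \<in> cartan0 l t nn"
      unfolding Y_def using xy t
      by (intro cartan0I l t nn coherent_add coherent_mult coherent_uminus) simp_all
    then have YZ: "Y \<in> Zl_mat l" using iff GL2_Zl by blast
    have "lmat_mul l Y h = lmat_mul l h X"
    proof
      fix k
      show "lmat_mul l Y h k = lmat_mul l h X k"
        unfolding lmat_mul_def x x' Y_def mat_mod_mult_left mat_mod_mult_right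
        by (subst twisted_mat_comm) simp
    qed
    moreover have "lmat_mul l X h = lmat_mul l h Y"
    proof
      fix k
      have "mat_mul (cartan_mat (t k) (nn k) (x k, y k)) (twisted_mat (t k) (nn k) (x' k, y' k))
          = mat_mul (twisted_mat (t k) (nn k) (x' k, y' k)) (cartan_mat (t k) (nn k) (x k + t k * y k, - y k))"
        using twisted_mat_comm[of "t k" "nn k" "x k + t k * y k" "- y k"] by simp
      then show "lmat_mul l X h k = lmat_mul l h Y k"
        unfolding lmat_mul_def x x' Y_def mat_mod_mult_left mat_mod_mult_right by simp
    qed
    ultimately have "Y = lmat_conj l h X" "X = lmat_conj l h Y"
      using lmat_conj_eqI[OF l hG] XZ YZ by blast+
    then show ?thesis using Y by metis
  qed
  show ?thesis
  proof
    show "lmat_conj l h ` cartan0 l t nn \<subseteq> cartan0 l t nn" using * by blast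
    show "cartan0 l t nn \<subseteq> lmat_conj l h ` cartan0 l t nn" using * by (metis imageI subsetI)
  qed
qed

lemma disc_coprime:
  assumes l: "prime l" and t: "coherent l t" and nn: "coherent l nn"
    and D: "\<not> int l dvd t 1 ^ 2 - 4 * nn 1" and n: "n \<ge> 1"
  shows "\<not> int l dvd t n ^ 2 - 4 * nn n" "coprime (t n ^ 2 - 4 * nn n) (int l ^ k)"
proof -
  have "[t n ^ 2 - 4 * nn n = t 1 ^ 2 - 4 * nn 1] (mod int l ^ 1)"
    by (intro cong_diff cong_mult cong_pow cong_refl coherent_cong t nn n)
  then have "int l ^ 1 dvd t n ^ 2 - 4 * nn n \<longleftrightarrow> int l ^ 1 dvd t 1 ^ 2 - 4 * nn 1"
    by (rule cong_dvd_iff)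
  then show *: "\<not> int l dvd t n ^ 2 - 4 * nn n" using D by simp
  then have "coprime (t n ^ 2 - 4 * nn n) (int l)"
    using l by (metis coprime_commute prime_imp_coprime prime_nat_int_transfer)
  then show "coprime (t n ^ 2 - 4 * nn n) (int l ^ k)" by simp
qed

text \<open>If \<open>h\<close> normalizes the Cartan subgroup, it conjugates the unit \<open>1 + l \<alpha>\<close> to a unit
  \<open>1 + l (X + Y \<alpha>)\<close>, so \<open>X + Y \<alpha>\<close> is conjugate to \<open>\<alpha>\<close>; this forces \<open>X + Y \<alpha>\<close> to be \<open>\<alpha>\<close> or \<open>t - \<alpha>\<close>,
  and then \<open>h\<close> is determined by its first column.\<close>

lemma normalizer_cartan0_subset:
  assumes l: "prime l" and t: "coherent l t" and nn: "coherent l nn"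
    and D: "\<not> int l dvd t 1 ^ 2 - 4 * nn 1"
    and hG: "h \<in> GL2 l" and hC: "lmat_conj l h ` cartan0 l t nn = cartan0 l t nn"
  shows "h \<in> cartan0 l t nn \<union> twisted l t nn"
proof -
  have l0: "l > 0" and l1: "l > 1" using prime_gt_0_nat[OF l] prime_gt_1_nat[OF l] by auto
  note iff = cartan0_iff[OF l0]
  have hZ: "h \<in> Zl_mat l" by (rule GL2_Zl[OF hG])
  obtain p q r s where h: "h = (\<lambda>n. (p n, q n, r n, s n))"
    and "p \<in> Zl l" "q \<in> Zl l" "r \<in> Zl l" "s \<in> Zl l"
    using hZ l0 by (rule Zl_mat_cases)
  then have coh: "coherent l p" "coherent l q" "coherent l r" "coherent l s"
    by (simp_all add: Zl_coherent)
  \<comment> \<open>\<alpha> need not be a unit, but \<open>1 + l \<alpha>\<close> always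
    is.\<close>
  define G where "G = (\<lambda>k. mat_mod (int l ^ k) (cartan_mat (t k) (nn k) (1, int l)))"
  have "\<not> int l dvd qform (t 1) (nn 1) 1 (int l)"
  proof
    assume "int l dvd qform (t 1) (nn 1) 1 (int l)"
    moreover have "qform (t 1) (nn 1) 1 (int l) = 1 + int l * (t 1 + nn 1 * int l)"
      by (simp add: qform_def power2_eq_square algebra_simps)
    ultimately have "int l dvd 1" by (metis dvd_add_left_iff dvd_triv_left)
    then show False using l1 by simp
  qed
  then have G: "G \<in> cartan0 l t nn"
    unfolding G_def by (intro cartan0I[where x = "\<lambda>_. 1" and y = "\<lambda>_. int l"] l t nn coherent_const)
  then have GG: "G \<in> GL2 l" using iff by blast
  have "lmat_conj l h G \<in> cartan0 l t nn" using hC G by blast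
  then obtain x y where xy: "coherent l x" "coherent l y"
    and x: "\<And>k. lmat_conj l h G k = mat_mod (int l ^ k) (cartan_mat (t k) (nn k) (x k, y k))"
    using iff by blast
  have E: "[(x k - 1) * p k - nn k * y k * r k = int l * q k] (mod int l ^ k)"
    "[(x k - 1) * q k - nn k * y k * s k = int l * (- nn k * p k + t k * q k)] (mod int l ^ k)"
    "[y k * p k + (x k - 1 + t k * y k) * r k = int l * s k] (mod int l ^ k)"
    "[y k * q k + (x k - 1 + t k * y k) * s k = int l * (- nn k * r k + t k * s k)] (mod int l ^ k)" for k
  proof -
    have hk: "h k = (p k, q k, r k, s k)"
      and Gk: "G k = mat_mod (int l ^ k) (cartan_mat (t k) (nn k) (1, int l))"
      by (simp_all add: h G_def)
    have "lmat_mul l (lmat_conj l h G) h k = lmat_mul l h G k" by (simp add: lmat_conj_mult[OF l hG GG])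
    then have "mat_mod (int l ^ k) (mat_mul (cartan_mat (t k) (nn k) (x k, y k)) (p k, q k, r k, s k))
      = mat_mod (int l ^ k) (mat_mul (p k, q k, r k, s k) (cartan_mat (t k) (nn k) (1, int l)))"
      unfolding lmat_mul_def x Gk hk mat_mod_mult_left mat_mod_mult_right .
    note e = this[unfolded cartan_mat_def split_conv mat_mul.simps mat_mod_eq_iff]
    have shift: "[a = b] (mod m)" if "[a' = b'] (mod m)" "a - b = a' - b'" for a b a' b' m :: int
      using that by (simp add: cong_iff_dvd_diff)
    show "[(x k - 1) * p k - nn k * y k * r k = int l * q k] (mod int l ^ k)"
      by (rule shift[OF e[THEN conjunct1]]) algebra
    show "[(x k - 1) * q k - nn k * y k * s k = int l * (- nn k * p k + t k * q k)] (mod int l ^ k)"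
      by (rule shift[OF e[THEN conjunct2, THEN conjunct1]]) algebra
    show "[y k * p k + (x k - 1 + t k * y k) * r k = int l * s k] (mod int l ^ k)"
      by (rule shift[OF e[THEN conjunct2, THEN conjunct2, THEN conjunct1]]) algebra
    show "[y k * q k + (x k - 1 + t k * y k) * s k = int l * (- nn k * r k + t k * s k)] (mod int l ^ k)"
      by (rule shift[OF e[THEN conjunct2, THEN conjunct2, THEN conjunct2]]) algebra
  qed
  have dc: "coprime (p k * s k - q k * r k) (int l ^ k)" for k
    using GL2_det_coprime[OF l hG, of k] by (simp add: h)
  \<comment> \<open>\<open>G\<close> is the identity modulo \<open>l\<close>, hence so is its
    conjugate; the adjugate of \<open>h\<close> cancels \<open>h\<close> in the congruences.\<close>
  have dvd: "int l dvd x (Suc n) - 1 \<and> int l dvd y (Suc n)" for n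
  proof -
    let ?k = "Suc n"
    define d where "d = p ?k * s ?k - q ?k * r ?k"
    have dl: "coprime (int l) d" using dc[of ?k] by (simp add: d_def coprime_commute)
    have E': "int l dvd a" if "[a = int l * b] (mod int l ^ ?k)" for a b
    proof -
      have "[a = int l * b] (mod int l)" using that by (rule cong_dvd_modulus) simp
      then show ?thesis by (simp add: cong_dvd_iff)
    qed
    note F = E[of ?k, THEN E']
    have "d * (x ?k - 1) = s ?k * ((x ?k - 1) * p ?k - nn ?k * y ?k * r ?k)
        - r ?k * ((x ?k - 1) * q ?k - nn ?k * y ?k * s ?k)"
      unfolding d_def by algebra
    moreover have "int l dvd \<dots>" by (intro dvd_diff dvd_mult F)
    moreover have "d * y ?k = s ?k * (y ?k * p ?k + (x ?k - 1 + t ?k * y ?k) * r ?k)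
        - r ?k * (y ?k * q ?k + (x ?k - 1 + t ?k * y ?k) * s ?k)"
      unfolding d_def by algebra
    moreover have "int l dvd \<dots>" by (intro dvd_diff dvd_mult F)
    ultimately have "int l dvd d * (x ?k - 1)" "int l dvd d * y ?k" by metis+
    then show ?thesis using dl coprime_dvd_mult_right_iff by blast
  qed
  \<comment> \<open>Division by \<open>l\<close> costs one power of \<open>l\<close>, so level
    \<open>n\<close> of \<open>X\<close> and \<open>Y\<close> comes from level
    \<open>Suc n\<close>.\<close>
  define X Y where "X = (\<lambda>n. (x (Suc n) - 1) div int l)" and "Y = (\<lambda>n. y (Suc n) div int l)"
  have X: "x (Suc n) - 1 = int l * X n" and Y: "y (Suc n) = int l * Y n" for n
    using dvd[of n] by (simp_all add: X_def Y_def)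
  have cancel: "[a = b] (mod int l ^ n)" if "[int l * a = int l * b] (mod int l ^ Suc n)" for a b n
  proof -
    have "int l * int l ^ n dvd int l * (a - b)"
      using that by (simp add: cong_iff_dvd_diff right_diff_distrib)
    then show ?thesis using l0 by (simp add: cong_iff_dvd_diff)
  qed
  have Xc: "coherent l X"
    unfolding coherent_def
  proof (intro allI, rule cancel)
    fix n
    have "[x (Suc (Suc n)) - 1 = x (Suc n) - 1] (mod int l ^ Suc n)"
      using xy(1) unfolding coherent_def by (blast intro: cong_diff cong_refl)
    then show "[int l * X (Suc n) = int l * X n] (mod int l ^ Suc n)" by (simp only: X)
  qed
  have Yc: "coherent l Y"
    unfolding coherent_def
  proof (intro allI, rule cancel)
    fix n
    have "[y (Suc (Suc n)) = y (Suc n)] (mod int l ^ Suc n)"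
      using xy(2) unfolding coherent_def by blast
    then show "[int l * Y (Suc n) = int l * Y n] (mod int l ^ Suc n)" by (simp only: Y)
  qed
  have e: "[X n * p (Suc n) - nn (Suc n) * Y n * r (Suc n) = q (Suc n)] (mod int l ^ n)"
    "[X n * q (Suc n) - nn (Suc n) * Y n * s (Suc n) = - nn (Suc n) * p (Suc n) + t (Suc n) * q (Suc n)] (mod int l ^ n)"
    "[Y n * p (Suc n) + (X n + t (Suc n) * Y n) * r (Suc n) = s (Suc n)] (mod int l ^ n)"
    "[Y n * q (Suc n) + (X n + t (Suc n) * Y n) * s (Suc n) = - nn (Suc n) * r (Suc n) + t (Suc n) * s (Suc n)] (mod int l ^ n)" for n
  proof -
    note E' = E[of "Suc n", unfolded X Y]
    have a: "int l * X n * u - nn (Suc n) * (int l * Y n) * v = int l * (X n * u - nn (Suc n) * Y n * v)"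
      "int l * Y n * u + (int l * X n + t (Suc n) * (int l * Y n)) * v
        = int l * (Y n * u + (X n + t (Suc n) * Y n) * v)" for u v
      by algebra+
    show "[X n * p (Suc n) - nn (Suc n) * Y n * r (Suc n) = q (Suc n)] (mod int l ^ n)"
      using E'(1) unfolding a by (rule cancel)
    show "[X n * q (Suc n) - nn (Suc n) * Y n * s (Suc n) = - nn (Suc n) * p (Suc n) + t (Suc n) * q (Suc n)] (mod int l ^ n)"
      using E'(2) unfolding a by (rule cancel)
    show "[Y n * p (Suc n) + (X n + t (Suc n) * Y n) * r (Suc n) = s (Suc n)] (mod int l ^ n)"
      using E'(3) unfolding a by (rule cancel)
    show "[Y n * q (Suc n) + (X n + t (Suc n) * Y n) * s (Suc n) = - nn (Suc n) * r (Suc n) + t (Suc n) * s (Suc n)] (mod int l ^ n)"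
      using E'(4) unfolding a by (rule cancel)
  qed
  have dcS: "coprime (p (Suc n) * s (Suc n) - q (Suc n) * r (Suc n)) (int l ^ n)" for n
    using dc[of "Suc n"] by simp
  have DcS: "coprime (t (Suc n) ^ 2 - 4 * nn (Suc n)) (int l ^ n)" for n
    by (rule disc_coprime(2)[OF l t nn D]) simp
  note gen = conj_generator[OF dcS e DcS]
  have sq: "int l ^ n dvd (Y n - 1) * (Y n + 1)" for n
  proof -
    have "int l ^ n dvd Y n ^ 2 - 1" using gen(2)[of n] by (simp only: cong_iff_dvd_diff)
    moreover have "Y n ^ 2 - 1 = (Y n - 1) * (Y n + 1)" by algebra
    ultimately show ?thesis by simp
  qed
  have not2: "\<not> (\<forall>n. int l ^ n dvd 2)"
  proof
    assume "\<forall>n. int l ^ n dvd 2"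
    then have "int l ^ 2 dvd 2" by blast
    then have "int l ^ 2 \<le> 2" by (rule zdvd_imp_le) simp
    moreover have "int l * int l \<ge> 2 * 2" using l1 by (intro mult_mono) auto
    ultimately show False by (simp add: power2_eq_square)
  qed
  \<comment> \<open>For \<open>l = 2\<close> the factor 2 is not invertible, but it is a nonzero
    l-adic integer and can be cancelled in a coherent sequence.\<close>
  have two: "\<forall>n. int l ^ n dvd z n" if "coherent l z" "\<And>n. int l ^ n dvd 2 * z n" for z
    using coherent_zero_divisor[OF l coherent_const[of l 2] that(1)] that(2) not2 by auto
  have hmod: "h n = mat_mod (int l ^ n) (p (Suc n), q (Suc n), r (Suc n), s (Suc n))" for n
    using hZ by (simp add: Zl_mat_iff_Suc h)
  have cS: "[u (Suc n) = u n] (mod int l ^ n)" if "coherent l u" for u n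
    using that by (simp add: coherent_def)
  \<comment> \<open>\<open>Y^2 = 1\<close> leaves only the signs \<plusminus>1 because the l-adic
    integers form a domain; modulo a fixed power of 2 there would be further roots.\<close>
  consider "\<forall>n. int l ^ n dvd Y n - 1" | "\<forall>n. int l ^ n dvd Y n + 1"
    using coherent_zero_divisor[OF l coherent_diff[OF Yc coherent_const[of l 1]]
      coherent_add[OF Yc coherent_const[of l 1]] sq] by blast
  then show ?thesis
  proof cases
    case 1
    have Y1: "[Y n = 1] (mod int l ^ n)" for n using 1 by (simp add: cong_iff_dvd_diff)
    have "int l ^ n dvd 2 * X n" for n
    proof -
      have "2 * X n = (2 * X n + t (Suc n) * Y n - t (Suc n)) - t (Suc n) * (Y n - 1)" by algebra
      moreover have "int l ^ n dvd (2 * X n + t (Suc n) * Y n - t (Suc n)) - t (Suc n) * (Y n - 1)"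
        using gen(1)[of n] 1 unfolding cong_iff_dvd_diff by (meson dvd_diff dvd_mult)
      ultimately show ?thesis by metis
    qed
    then have X0: "[X n = 0] (mod int l ^ n)" for n using two[OF Xc] by (simp add: cong_0_iff)
    have "h n = mat_mod (int l ^ n) (cartan_mat (t n) (nn n) (p n, r n))" for n
    proof -
      have "[X n * p (Suc n) - nn (Suc n) * Y n * r (Suc n) = 0 * p (Suc n) - nn (Suc n) * 1 * r (Suc n)] (mod int l ^ n)"
        by (intro cong_diff cong_mult cong_refl X0 Y1)
      then have "[q (Suc n) = - nn (Suc n) * r (Suc n)] (mod int l ^ n)"
        using cong_trans[OF cong_sym[OF e(1)[of n]]] by fastforce
      moreover have "[Y n * p (Suc n) + (X n + t (Suc n) * Y n) * r (Suc n)
          = 1 * p (Suc n) + (0 + t (Suc n) * 1) * r (Suc n)] (mod int l ^ n)"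
        by (intro cong_add cong_mult cong_refl X0 Y1)
      then have "[s (Suc n) = p (Suc n) + t (Suc n) * r (Suc n)] (mod int l ^ n)"
        using cong_trans[OF cong_sym[OF e(3)[of n]]] by fastforce
      ultimately have "h n = mat_mod (int l ^ n) (cartan_mat (t (Suc n)) (nn (Suc n)) (p (Suc n), r (Suc n)))"
        unfolding hmod cartan_mat_def split_conv mat_mod_eq_iff by simp
      also have "\<dots> = mat_mod (int l ^ n) (cartan_mat (t n) (nn n) (p n, r n))"
        by (intro cartan_mat_cong cS t nn coh)
      finally show ?thesis .
    qed
    then show ?thesis using hG coh iff by blast
  next
    case 2
    have Y1: "[Y n = - 1] (mod int l ^ n)" for n using 2 by (simp add: cong_iff_dvd_diff)
    have tc: "coherent l (\<lambda>n. X n - t (Suc n))"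
    proof (rule coherent_diff[OF Xc])
      show "coherent l (\<lambda>n. t (Suc n))" by (rule coherent_cong_trans[OF t cS[OF t]])
    qed
    have "int l ^ n dvd 2 * (X n - t (Suc n))" for n
    proof -
      have "2 * (X n - t (Suc n)) = (2 * X n + t (Suc n) * Y n - t (Suc n)) - t (Suc n) * (Y n + 1)" by algebra
      moreover have "int l ^ n dvd (2 * X n + t (Suc n) * Y n - t (Suc n)) - t (Suc n) * (Y n + 1)"
        using gen(1)[of n] 2 unfolding cong_iff_dvd_diff by (meson dvd_diff dvd_mult)
      ultimately show ?thesis by metis
    qed
    then have X0: "[X n = t (Suc n)] (mod int l ^ n)" for n
      using two[OF tc] by (simp add: cong_iff_dvd_diff)
    have "h n = mat_mod (int l ^ n) (twisted_mat (t n) (nn n) (p n, r n))" for n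
    proof -
      have "[X n * p (Suc n) - nn (Suc n) * Y n * r (Suc n)
          = t (Suc n) * p (Suc n) - nn (Suc n) * (- 1) * r (Suc n)] (mod int l ^ n)"
        by (intro cong_diff cong_mult cong_refl X0 Y1)
      moreover have "t (Suc n) * p (Suc n) - nn (Suc n) * (- 1) * r (Suc n)
          = t (Suc n) * p (Suc n) + nn (Suc n) * r (Suc n)" by simp
      ultimately have "[q (Suc n) = t (Suc n) * p (Suc n) + nn (Suc n) * r (Suc n)] (mod int l ^ n)"
        using cong_trans[OF cong_sym[OF e(1)[of n]]] by metis
      moreover have "[Y n * p (Suc n) + (X n + t (Suc n) * Y n) * r (Suc n)
          = (- 1) * p (Suc n) + (t (Suc n) + t (Suc n) * (- 1)) * r (Suc n)] (mod int l ^ n)"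
        by (intro cong_add cong_mult cong_refl X0 Y1)
      moreover have "(- 1) * p (Suc n) + (t (Suc n) + t (Suc n) * (- 1)) * r (Suc n) = - p (Suc n)" by simp
      ultimately have "[s (Suc n) = - p (Suc n)] (mod int l ^ n)"
        using cong_trans[OF cong_sym[OF e(3)[of n]]] by metis
      with \<open>[q (Suc n) = t (Suc n) * p (Suc n) + nn (Suc n) * r (Suc n)] (mod int l ^ n)\<close>
      have "h n = mat_mod (int l ^ n) (twisted_mat (t (Suc n)) (nn (Suc n)) (p (Suc n), r (Suc n)))"
        unfolding hmod twisted_mat_def split_conv mat_mod_eq_iff by simp
      also have "\<dots> = mat_mod (int l ^ n) (twisted_mat (t n) (nn n) (p n, r n))"
        by (intro twisted_mat_cong cS t nn coh)
      finally show ?thesis .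
    qed
    then show ?thesis using hG coh unfolding twisted_def by blast
  qed
qed

lemma cartan0_GL2: "cartan0 l t nn \<subseteq> GL2 l"
  by (auto simp: cartan0_def)

lemma twisted_GL2: "twisted l t nn \<subseteq> GL2 l"
  by (auto simp: twisted_def)

lemma normalizer_cartan0:
  assumes l: "prime l" and t: "coherent l t" and nn: "coherent l nn"
    and D: "\<not> int l dvd t 1 ^ 2 - 4 * nn 1"
  shows "normalizer l (cartan0 l t nn) = cartan0 l t nn \<union> twisted l t nn"
proof -
  have "normalizer l (cartan0 l t nn) = {h \<in> GL2 l. lmat_conj l h ` cartan0 l t nn = cartan0 l t nn}"
    using conj_set_eq[OF l _ cartan0_GL2] by (auto simp: normalizer_def)
  also have "\<dots> = cartan0 l t nn \<union> twisted l t nn"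
  proof (intro subset_antisym subsetI)
    fix h assume "h \<in> {h \<in> GL2 l. lmat_conj l h ` cartan0 l t nn = cartan0 l t nn}"
    then show "h \<in> cartan0 l t nn \<union> twisted l t nn"
      using normalizer_cartan0_subset[OF assms, of h] by simp
  next
    fix h assume h: "h \<in> cartan0 l t nn \<union> twisted l t nn"
    then have "h \<in> GL2 l" using cartan0_GL2 twisted_GL2 by blast
    moreover have "lmat_conj l h ` cartan0 l t nn = cartan0 l t nn"
      using h lmat_conj_cartan0[OF l t nn, of h] lmat_conj_twisted[OF l t nn, of h] by (elim UnE)
    ultimately show "h \<in> {h \<in> GL2 l. lmat_conj l h ` cartan0 l t nn = cartan0 l t nn}" by simp
  qed
  finally show ?thesis .
qed

section \<open>Densities\<close>

abbreviation level :: "nat \<Rightarrow> lmat set \<Rightarrow> imat set" where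
  "level n S \<equiv> (\<lambda>M. M n) ` S"

lemma finite_level:
  assumes "l > 0" "S \<subseteq> Zl_mat l"
  shows "finite (level n S)"
proof -
  let ?I = "{0..<int l ^ n}"
  have "M n \<in> ?I \<times> ?I \<times> ?I \<times> ?I" if "M \<in> S" for M
  proof -
    obtain a b c d where "M n = (a,b,c,d)" by (metis prod_cases4)
    moreover have "M n = mat_mod (int l ^ n) (M n)" using that assms(2) by (auto simp: Zl_mat_def)
    ultimately have "M n = (a mod int l ^ n, b mod int l ^ n, c mod int l ^ n, d mod int l ^ n)" by simp
    then show ?thesis using assms(1) by simp
  qed
  then have "level n S \<subseteq> ?I \<times> ?I \<times> ?I \<times> ?I" by blast
  then show ?thesis by (rule finite_subset) simp
qed

text \<open>Conjugation descends to reductions, so it cannot increase their number; the same bound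
  for the inverse conjugation gives equality.\<close>

lemma card_level_lmat_conj:
  assumes l: "prime l" and g: "g \<in> GL2 l" and S: "S \<subseteq> GL2 l"
  shows "card (level n (lmat_conj l g ` S)) = card (level n S)"
proof -
  have l0: "l > 0" by (rule prime_gt_0_nat[OF l])
  have le: "card (level n (lmat_conj l h ` R)) \<le> card (level n R)" if "R \<subseteq> GL2 l" for h R
  proof -
    define F where "F = (\<lambda>A. mat_mod (int l ^ n) (mat_mul (mat_mod (int l ^ n) (mat_mul (h n) A))
      ((inv\<^bsub>GL2_group l\<^esub> h) n)))"
    have "level n (lmat_conj l h ` R) = F ` level n R"
      by (simp add: image_image lmat_conj_def lmat_mul_def F_def)
    moreover have "finite (level n R)"
      using that GL2_Zl by (intro finite_level[OF l0]) blast
    ultimately show ?thesis by (simp add: card_image_le)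
  qed
  let ?i = "inv\<^bsub>GL2_group l\<^esub> g"
  have "lmat_conj l g ` S \<subseteq> GL2 l" using lmat_conj_GL2[OF l g] S by blast
  then have "card (level n (lmat_conj l ?i ` lmat_conj l g ` S)) \<le> card (level n (lmat_conj l g ` S))" by (rule le)
  moreover have "(\<lambda>X. lmat_conj l ?i (lmat_conj l g X)) ` S = (\<lambda>X. X) ` S"
    using lmat_conj_inv(1)[OF l g] S by (intro image_cong) auto
  then have "lmat_conj l ?i ` lmat_conj l g ` S = S" by (simp add: image_image)
  ultimately have "card (level n S) \<le> card (level n (lmat_conj l g ` S))" by simp
  with le[OF S] show ?thesis by (rule antisym)
qed

section \<open>Conjugation and the determinant of \<open>M - I\<close>\<close>

fun det_minus_one :: "imat \<Rightarrow> int" where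
  "det_minus_one (a,b,c,d) = (a - 1) * (d - 1) - b * c"

lemma det_minus_one_mod: "[det_minus_one (mat_mod m A) = det_minus_one A] (mod m)"
  by (cases A) (auto intro!: cong_diff cong_mult)

lemma det_minus_one_twisted: "det_minus_one (twisted_mat t n (x,y)) = 1 - qform t n x y"
  by (simp add: twisted_mat_def qform_def power2_eq_square algebra_simps)

text \<open>\<open>det (M - I)\<close> is the determinant minus the trace plus 1, and both are
  invariant under conjugation.\<close>

lemma det_minus_one_conj:
  assumes g: "coprime (mat_det G) m" and e: "mat_mod m (mat_mul M G) = mat_mod m (mat_mul G X)"
  shows "[det_minus_one M = det_minus_one X] (mod m)"
proof -
  obtain a b c d where M: "M = (a,b,c,d)" by (metis prod_cases4)
  obtain p q r s where G: "G = (p,q,r,s)" by (metis prod_cases4)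
  obtain x y z w where X: "X = (x,y,z,w)" by (metis prod_cases4)
  have e1: "[a * p + b * r = p * x + q * z] (mod m)" and e2: "[a * q + b * s = p * y + q * w] (mod m)"
    and e3: "[c * p + d * r = r * x + s * z] (mod m)" and e4: "[c * q + d * s = r * y + s * w] (mod m)"
    using e unfolding M G X mat_mul.simps mat_mod_eq_iff by blast+
  \<comment> \<open>Each side is the determinant of a product minus the trace of that product
    multiplied by the adjugate of \<open>G\<close>. On the two sides this is \<open>det G\<close>
    times determinant minus trace of \<open>M\<close> and of \<open>X\<close>, so only
    \<open>det G\<close> has to be cancelled.\<close>
  have "[(a * p + b * r) * (c * q + d * s) - (a * q + b * s) * (c * p + d * r)
      - (s * (a * p + b * r) - r * (a * q + b * s) + (p * (c * q + d * s) - q * (c * p + d * r)))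
    = (p * x + q * z) * (r * y + s * w) - (p * y + q * w) * (r * x + s * z)
      - (s * (p * x + q * z) - r * (p * y + q * w) + (p * (r * y + s * w) - q * (r * x + s * z)))] (mod m)"
    by (intro cong_add cong_diff cong_mult e1 e2 e3 e4 cong_refl)
  then have "m dvd ((a * p + b * r) * (c * q + d * s) - (a * q + b * s) * (c * p + d * r)
      - (s * (a * p + b * r) - r * (a * q + b * s) + (p * (c * q + d * s) - q * (c * p + d * r))))
    - ((p * x + q * z) * (r * y + s * w) - (p * y + q * w) * (r * x + s * z)
      - (s * (p * x + q * z) - r * (p * y + q * w) + (p * (r * y + s * w) - q * (r * x + s * z))))"
    by (simp only: cong_iff_dvd_diff)
  also have "((a * p + b * r) * (c * q + d * s) - (a * q + b * s) * (c * p + d * r)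
      - (s * (a * p + b * r) - r * (a * q + b * s) + (p * (c * q + d * s) - q * (c * p + d * r))))
    - ((p * x + q * z) * (r * y + s * w) - (p * y + q * w) * (r * x + s * z)
      - (s * (p * x + q * z) - r * (p * y + q * w) + (p * (r * y + s * w) - q * (r * x + s * z))))
    = mat_det G * (det_minus_one M - det_minus_one X)"
    unfolding M G X mat_det.simps det_minus_one.simps by algebra
  finally have "m dvd det_minus_one M - det_minus_one X"
    using g by (simp add: coprime_dvd_mult_right_iff coprime_commute)
  then show ?thesis by (simp only: cong_iff_dvd_diff)
qed

text \<open>Multiplication by the adjugate cancels the invertible matrix on the left. It transfers
  congruence to the identity from a conjugate back to the original matrix.\<close>

lemma conj_identity:
  assumes g: "coprime (p * s - q * r) m"
    and e: "mat_mod m (p,q,r,s) = mat_mod m (mat_mul (p,q,r,s) (x,y,z,w))"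
  shows "m dvd x - 1" "m dvd y" "m dvd z" "m dvd w - 1"
proof -
  define d where "d = p * s - q * r"
  have e': "m dvd p - (p * x + q * z)" "m dvd q - (p * y + q * w)"
    "m dvd r - (r * x + s * z)" "m dvd s - (r * y + s * w)"
    using e unfolding mat_mul.simps mat_mod_eq_iff cong_iff_dvd_diff by blast+
  have canc: "m dvd k" if "m dvd d * k" for k
    using that g unfolding d_def by (metis coprime_commute coprime_dvd_mult_right_iff)
  have "m dvd q * (r - (r * x + s * z)) - s * (p - (p * x + q * z))" by (intro dvd_diff dvd_mult e')
  also have "\<dots> = d * (x - 1)" unfolding d_def by algebra
  finally show "m dvd x - 1" by (rule canc)
  have "m dvd q * (s - (r * y + s * w)) - s * (q - (p * y + q * w))" by (intro dvd_diff dvd_mult e')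
  also have "\<dots> = d * y" unfolding d_def by algebra
  finally show "m dvd y" by (rule canc)
  have "m dvd r * (p - (p * x + q * z)) - p * (r - (r * x + s * z))" by (intro dvd_diff dvd_mult e')
  also have "\<dots> = d * z" unfolding d_def by algebra
  finally show "m dvd z" by (rule canc)
  have "m dvd r * (q - (p * y + q * w)) - p * (s - (r * y + s * w))" by (intro dvd_diff dvd_mult e')
  also have "\<dots> = d * (w - 1)" unfolding d_def by algebra
  finally show "m dvd w - 1" by (rule canc)
qed

lemma cartan_mat_inj: "inj_on (\<lambda>p. mat_mod m (cartan_mat t n p)) (box m)"
  by (intro inj_onI) (auto simp: box_def cartan_mat_def)

lemma twisted_mat_inj: "inj_on (\<lambda>p. mat_mod m (twisted_mat t n p)) (box m)"
  by (intro inj_onI) (auto simp: box_def twisted_mat_def)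

section \<open>Reductions of the Cartan subgroup and of its twisted coset\<close>

context
  fixes l :: nat and t nn :: "nat \<Rightarrow> int"
  assumes l: "prime l" and t: "coherent l t" and nn: "coherent l nn"
    and D: "\<not> int l dvd t 1 ^ 2 - 4 * nn 1"
begin

abbreviation "norm_at n p \<equiv> qform (t n) (nn n) (fst p) (snd p)"

lemma l_pos: "l > 0"
  by (rule prime_gt_0_nat[OF l])

lemma norm_at_cong:
  assumes "coherent l x" "coherent l y" "k \<le> n"
  shows "[qform (t n) (nn n) (x n mod int l ^ n) (y n mod int l ^ n) = qform (t k) (nn k) (x k) (y k)] (mod int l ^ k)"
proof -
  have r: "[z n mod int l ^ n = z k] (mod int l ^ k)" if "coherent l z" for z
  proof -
    have "[z n mod int l ^ n = z n] (mod int l ^ n)" by simp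
    then have "[z n mod int l ^ n = z n] (mod int l ^ k)"
      by (rule cong_dvd_modulus) (simp add: assms(3) le_imp_power_dvd)
    also have "[z n = z k] (mod int l ^ k)" by (rule coherent_cong[OF that assms(3)])
    finally show ?thesis .
  qed
  show ?thesis
    by (rule qform_cong_all[OF coherent_cong[OF t assms(3)] coherent_cong[OF nn assms(3)]
        r[OF assms(1)] r[OF assms(2)]])
qed

lemma unit_pairs_level:
  assumes "coherent l x" "coherent l y" "n \<ge> 1"
  shows "(x n mod int l ^ n, y n mod int l ^ n) \<in> unit_pairs l (t n) (nn n) n
    \<longleftrightarrow> \<not> int l dvd qform (t 1) (nn 1) (x 1) (y 1)"
  using cong_dvd_iff[OF norm_at_cong[OF assms]] l_pos
  by (simp add: unit_pairs_def box_def)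

lemma unit_pairs_level_const:
  assumes "p \<in> unit_pairs l (t n) (nn n) n" "n \<ge> 1"
  shows "\<not> int l dvd qform (t 1) (nn 1) (fst p) (snd p)"
  using unit_pairs_level[OF coherent_const[of l "fst p"] coherent_const[of l "snd p"] assms(2)] assms(1)
  by (auto simp: unit_pairs_def box_def)

lemma cartan0_det:
  assumes "M \<in> GL2 l" "\<And>k. M k = mat_mod (int l ^ k) (cartan_mat (t k) (nn k) (x k, y k))"
  shows "\<not> int l dvd qform (t 1) (nn 1) (x 1) (y 1)"
  using assms(1) cong_dvd_iff[OF mat_det_mod[of "int l" "cartan_mat (t 1) (nn 1) (x 1, y 1)"]]
  by (simp add: GL2_def assms(2) det_cartan_mat)

lemma twisted_det:
  assumes "M \<in> GL2 l" "\<And>k. M k = mat_mod (int l ^ k) (twisted_mat (t k) (nn k) (x k, y k))"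
  shows "\<not> int l dvd qform (t 1) (nn 1) (x 1) (y 1)"
  using assms(1) cong_dvd_iff[OF mat_det_mod[of "int l" "twisted_mat (t 1) (nn 1) (x 1, y 1)"]]
  by (simp add: GL2_def assms(2) det_twisted_mat)

text \<open>Nothing is lost by reduction: every unit pair of residues lifts, already with constant
  coordinate sequences.\<close>

lemma level_cartan0:
  assumes n: "n \<ge> 1"
  shows "level n (cartan0 l t nn)
    = (\<lambda>p. mat_mod (int l ^ n) (cartan_mat (t n) (nn n) p)) ` unit_pairs l (t n) (nn n) n"
proof (intro subset_antisym subsetI)
  fix A assume "A \<in> level n (cartan0 l t nn)"
  then obtain M x y where A: "A = M n" and M: "M \<in> GL2 l" and xy: "coherent l x" "coherent l y"
    and Mk: "\<And>k. M k = mat_mod (int l ^ k) (cartan_mat (t k) (nn k) (x k, y k))"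
    unfolding cartan0_iff[OF l_pos] by blast
  have "A = mat_mod (int l ^ n) (cartan_mat (t n) (nn n) (x n mod int l ^ n, y n mod int l ^ n))"
    unfolding A Mk[of n] by (rule cartan_mat_cong) (simp_all add: cong_def)
  moreover have "(x n mod int l ^ n, y n mod int l ^ n) \<in> unit_pairs l (t n) (nn n) n"
    using unit_pairs_level[OF xy n] cartan0_det[OF M Mk] by blast
  ultimately show "A \<in> (\<lambda>p. mat_mod (int l ^ n) (cartan_mat (t n) (nn n) p)) ` unit_pairs l (t n) (nn n) n"
    by (rule image_eqI)
next
  fix A assume "A \<in> (\<lambda>p. mat_mod (int l ^ n) (cartan_mat (t n) (nn n) p)) ` unit_pairs l (t n) (nn n) n"
  then obtain p where p: "p \<in> unit_pairs l (t n) (nn n) n" "A = mat_mod (int l ^ n) (cartan_mat (t n) (nn n) p)"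
    by blast
  have "(\<lambda>k. mat_mod (int l ^ k) (cartan_mat (t k) (nn k) (fst p, snd p))) \<in> cartan0 l t nn"
    by (rule cartan0I[OF l t nn coherent_const coherent_const unit_pairs_level_const[OF p(1) n]])
  then have "mat_mod (int l ^ n) (cartan_mat (t n) (nn n) (fst p, snd p)) \<in> level n (cartan0 l t nn)"
    by (rule rev_image_eqI) simp
  then show "A \<in> level n (cartan0 l t nn)" by (simp add: p(2))
qed

text \<open>\<open>P\<close> may depend on the whole l-adic matrix, provided that level
  \<open>n\<close> of its coordinates decides it through \<open>Q\<close>.\<close>

lemma level_twisted:
  assumes n: "n \<ge> 1" and P: "\<And>X x y. X \<in> twisted l t nn \<Longrightarrow> coherent l x \<Longrightarrow> coherent l y \<Longrightarrow>
      (\<And>k. X k = mat_mod (int l ^ k) (twisted_mat (t k) (nn k) (x k, y k))) \<Longrightarrow>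
      P X \<longleftrightarrow> Q (x n mod int l ^ n, y n mod int l ^ n)"
  shows "level n {X \<in> twisted l t nn. P X}
    = (\<lambda>p. mat_mod (int l ^ n) (twisted_mat (t n) (nn n) p)) ` {p \<in> unit_pairs l (t n) (nn n) n. Q p}"
proof (intro subset_antisym subsetI)
  fix A assume "A \<in> level n {X \<in> twisted l t nn. P X}"
  then obtain M where A: "A = M n" and MT: "M \<in> twisted l t nn" and PM: "P M" by blast
  then obtain x y where M: "M \<in> GL2 l" and xy: "coherent l x" "coherent l y"
    and Mk: "\<And>k. M k = mat_mod (int l ^ k) (twisted_mat (t k) (nn k) (x k, y k))"
    unfolding twisted_def by blast
  have "A = mat_mod (int l ^ n) (twisted_mat (t n) (nn n) (x n mod int l ^ n, y n mod int l ^ n))"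
    unfolding A Mk[of n] by (rule twisted_mat_cong) (simp_all add: cong_def)
  moreover have "(x n mod int l ^ n, y n mod int l ^ n) \<in> unit_pairs l (t n) (nn n) n"
    using unit_pairs_level[OF xy n] twisted_det[OF M Mk] by blast
  moreover have "Q (x n mod int l ^ n, y n mod int l ^ n)"
    using P[OF MT xy Mk] PM by blast
  ultimately show "A \<in> (\<lambda>p. mat_mod (int l ^ n) (twisted_mat (t n) (nn n) p)) ` {p \<in> unit_pairs l (t n) (nn n) n. Q p}"
    by blast
next
  fix A assume "A \<in> (\<lambda>p. mat_mod (int l ^ n) (twisted_mat (t n) (nn n) p)) ` {p \<in> unit_pairs l (t n) (nn n) n. Q p}"
  then obtain p where p: "p \<in> unit_pairs l (t n) (nn n) n" "Q p"
    "A = mat_mod (int l ^ n) (twisted_mat (t n) (nn n) p)" by blast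
  define X where "X = (\<lambda>k. mat_mod (int l ^ k) (twisted_mat (t k) (nn k) (fst p, snd p)))"
  have XT: "X \<in> twisted l t nn" unfolding X_def
    by (rule twistedI[OF l t nn coherent_const coherent_const unit_pairs_level_const[OF p(1) n]])
  have "(fst p mod int l ^ n, snd p mod int l ^ n) = p"
    using p(1) by (auto simp: unit_pairs_def box_def)
  then have "P X"
    using P[OF XT coherent_const[of l "fst p"] coherent_const[of l "snd p"]] p(2) by (simp add: X_def)
  moreover have "X n = A" by (simp add: X_def p(3))
  ultimately show "A \<in> level n {X \<in> twisted l t nn. P X}" using XT by blast
qed

lemma unit_pairs_box: "unit_pairs l a b n \<subseteq> box (int l ^ n)"
  by (auto simp: unit_pairs_def)

lemma card_level_cartan0:
  assumes "n \<ge> 1"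
  shows "card (level n (cartan0 l t nn)) = card (unit_pairs l (t n) (nn n) n)"
  unfolding level_cartan0[OF assms]
  by (rule card_image[OF inj_on_subset[OF cartan_mat_inj unit_pairs_box]])

lemma card_level_twisted:
  assumes n: "n \<ge> 1" and P: "\<And>X x y. X \<in> twisted l t nn \<Longrightarrow> coherent l x \<Longrightarrow> coherent l y \<Longrightarrow>
      (\<And>k. X k = mat_mod (int l ^ k) (twisted_mat (t k) (nn k) (x k, y k))) \<Longrightarrow>
      P X \<longleftrightarrow> Q (x n mod int l ^ n, y n mod int l ^ n)"
  shows "card (level n {X \<in> twisted l t nn. P X}) = card {p \<in> unit_pairs l (t n) (nn n) n. Q p}"
proof -
  have "level n {X \<in> twisted l t nn. P X}
      = (\<lambda>p. mat_mod (int l ^ n) (twisted_mat (t n) (nn n) p)) ` {p \<in> unit_pairs l (t n) (nn n) n. Q p}"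
    by (rule level_twisted[OF n, where P = P and Q = Q]) (rule P)
  moreover have "{p \<in> unit_pairs l (t n) (nn n) n. Q p} \<subseteq> box (int l ^ n)"
    using unit_pairs_box by blast
  ultimately show ?thesis by (simp add: card_image inj_on_subset[OF twisted_mat_inj])
qed

lemma card_level_twisted_UNIV:
  assumes "n \<ge> 1"
  shows "card (level n (twisted l t nn)) = card (level n (cartan0 l t nn))"
  using card_level_twisted[OF assms, of "\<lambda>_. True" "\<lambda>_. True"] card_level_cartan0[OF assms] by simp

text \<open>Equating \<open>u\<close> and \<open>u' \<sigma>\<close> identifies the coordinates of
  \<open>u\<close> and \<open>u'\<close>, and the remaining two entries say that the gradient of the
  norm vanishes at \<open>u\<close>; then \<open>u\<close> is not a unit. At level 0 the two images
  coincide.\<close>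

lemma level_disjoint:
  assumes n: "n \<ge> 1"
  shows "level n (cartan0 l t nn) \<inter> level n (twisted l t nn) = {}"
proof (rule ccontr)
  assume "\<not> ?thesis"
  moreover have "level n (twisted l t nn)
      = (\<lambda>p. mat_mod (int l ^ n) (twisted_mat (t n) (nn n) p)) ` unit_pairs l (t n) (nn n) n"
    using level_twisted[OF n, of "\<lambda>_. True" "\<lambda>_. True"] by simp
  ultimately obtain p p' where p: "p \<in> unit_pairs l (t n) (nn n) n"
    and e: "mat_mod (int l ^ n) (cartan_mat (t n) (nn n) p) = mat_mod (int l ^ n) (twisted_mat (t n) (nn n) p')"
    unfolding level_cartan0[OF n] by blast
  obtain x y x' y' where pp: "p = (x,y)" "p' = (x',y')" by (metis surj_pair)
  have dl: "int l dvd a - b" if "[a = b] (mod int l ^ n)" for a b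
  proof -
    have "int l dvd int l ^ n" using n by simp
    then show ?thesis using that by (metis cong_iff_dvd_diff dvd_trans)
  qed
  have e': "[x = x'] (mod int l ^ n)" "[- nn n * y = t n * x' + nn n * y'] (mod int l ^ n)"
    "[y = y'] (mod int l ^ n)" "[x + t n * y = - x'] (mod int l ^ n)"
    using e unfolding pp cartan_mat_def twisted_mat_def split_conv mat_mod_eq_iff by blast+
  note d = e'[THEN dl]
  have "int l dvd (x + t n * y - - x') + (x - x')" by (intro dvd_add d)
  also have "\<dots> = 2 * x + t n * y" by algebra
  finally have 1: "int l dvd 2 * x + t n * y" .
  have "int l dvd t n * (x - x') + nn n * (y - y') - (- nn n * y - (t n * x' + nn n * y'))"
    by (intro dvd_add dvd_diff dvd_mult d)
  also have "\<dots> = t n * x + 2 * nn n * y" by algebra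
  finally have 2: "int l dvd t n * x + 2 * nn n * y" .
  have "int l dvd x \<and> int l dvd y"
    using l by (intro disc_gradient[OF disc_coprime(1)[OF l t nn D n] 1 2]) simp
  then have "int l dvd qform (t n) (nn n) x y" by (simp add: qform_def power2_eq_square)
  then show False using p by (simp add: pp unit_pairs_def)
qed

lemma card_level_cartan0_Suc:
  "card (level (Suc k) (cartan0 l t nn)) = l ^ (2 * k) * card (level 1 (cartan0 l t nn))"
proof -
  have "unit_pairs l (t (Suc k)) (nn (Suc k)) 1 = unit_pairs l (t 1) (nn 1) 1"
  proof -
    have "int l dvd qform (t (Suc k)) (nn (Suc k)) x y \<longleftrightarrow> int l dvd qform (t 1) (nn 1) x y" for x y
    proof (intro cong_dvd_iff qform_cong_all cong_refl)
      show "[t (Suc k) = t 1] (mod int l)" "[nn (Suc k) = nn 1] (mod int l)"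
        using coherent_cong[OF t, of 1 "Suc k"] coherent_cong[OF nn, of 1 "Suc k"] by simp_all
    qed
    then show ?thesis by (simp add: unit_pairs_def)
  qed
  moreover have "card (level (Suc k) (cartan0 l t nn)) = card (unit_pairs l (t (Suc k)) (nn (Suc k)) (Suc k))"
    and "card (level 1 (cartan0 l t nn)) = card (unit_pairs l (t 1) (nn 1) 1)"
    by (rule card_level_cartan0, simp)+
  ultimately show ?thesis using card_unit_pairs[OF l, of "t (Suc k)" "nn (Suc k)" k] by metis
qed

text \<open>A reduction modulo \<open>l^n\<close> has at most \<open>l^2\<close> lifts, as a Cartan
  matrix is determined by two coordinates.\<close>

lemma card_level_Suc_le:
  assumes S: "S \<subseteq> cartan0 l t nn"
  shows "card (level (Suc n) S) \<le> l ^ 2 * card (level n S)"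
proof -
  define m where "m = int l ^ n"
  have m0: "m > 0" using l_pos by (simp add: m_def)
  \<comment> \<open>The first column of a reduced Cartan matrix holds its coordinates
    \<open>x\<close> and \<open>y\<close>; \<open>f\<close> records the reduction together with
    their leading base-\<open>l\<close> digits.\<close>
  define f :: "imat \<Rightarrow> imat \<times> int \<times> int"
    where "f = (\<lambda>A. (mat_mod m A, fst A div m, fst (snd (snd A)) div m))"
  have SZ: "S \<subseteq> Zl_mat l" using S cartan0_GL2 GL2_Zl by blast
  have form: "\<exists>p\<in>box (int l ^ Suc n). A = mat_mod (int l ^ Suc n) (cartan_mat (t (Suc n)) (nn (Suc n)) p)"
    if "A \<in> level (Suc n) S" for A
  proof -
    have "A \<in> level (Suc n) (cartan0 l t nn)" using that S by blast
    moreover have "Suc n \<ge> 1" by simp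
    ultimately show ?thesis using level_cartan0 unit_pairs_box by blast
  qed
  have fst: "fst (mat_mod k (cartan_mat a b p)) = fst p mod k"
    "fst (snd (snd (mat_mod k (cartan_mat a b p)))) = snd p mod k" for k a b p
    by (cases p; simp add: cartan_mat_def)+
  have "inj_on f (level (Suc n) S)"
  proof (rule inj_onI)
    fix A B assume A: "A \<in> level (Suc n) S" and B: "B \<in> level (Suc n) S" and e: "f A = f B"
    obtain p where p: "p \<in> box (int l ^ Suc n)" "A = mat_mod (int l ^ Suc n) (cartan_mat (t (Suc n)) (nn (Suc n)) p)"
      using form[OF A] by blast
    obtain p' where p': "p' \<in> box (int l ^ Suc n)" "B = mat_mod (int l ^ Suc n) (cartan_mat (t (Suc n)) (nn (Suc n)) p')"
      using form[OF B] by blast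
    have fA: "fst A = fst p" "fst (snd (snd A)) = snd p" and fB: "fst B = fst p'" "fst (snd (snd B)) = snd p'"
      using p p' by (auto simp: fst box_def)
    have modf: "fst (mat_mod m Z) = fst Z mod m" "fst (snd (snd (mat_mod m Z))) = fst (snd (snd Z)) mod m" for Z
      by (cases Z; simp)+
    have dm: "fst p div m = fst p' div m" "snd p div m = snd p' div m"
      using e by (simp_all add: f_def fA fB)
    have "mat_mod m A = mat_mod m B" using e by (simp add: f_def)
    then have "fst p mod m = fst p' mod m" "snd p mod m = snd p' mod m"
      using modf[of A] modf[of B] by (simp_all add: fA fB)
    with dm have "fst p = fst p'" "snd p = snd p'"
      by (metis div_mult_mod_eq)+
    then have "p = p'" by (rule prod_eqI)
    then show "A = B" by (simp add: p p')
  qed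
  moreover have "f ` level (Suc n) S \<subseteq> level n S \<times> box (int l)"
  proof
    fix z assume "z \<in> f ` level (Suc n) S"
    then obtain M where M: "M \<in> S" "z = f (M (Suc n))" by blast
    obtain p where p: "p \<in> box (int l ^ Suc n)" "M (Suc n) = mat_mod (int l ^ Suc n) (cartan_mat (t (Suc n)) (nn (Suc n)) p)"
      using form[of "M (Suc n)"] M(1) by blast
    have dv: "0 \<le> a div m \<and> a div m < int l" if "0 \<le> a" "a < int l ^ Suc n" for a
    proof
      show "0 \<le> a div m" using that m0 by (simp add: pos_imp_zdiv_nonneg_iff)
      have "m * (a div m) \<le> a" using m0 by (simp flip: minus_mod_eq_mult_div)
      also have "a < m * int l" using that by (simp add: m_def mult.commute)
      finally show "a div m < int l" using m0 by simp
    qed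
    have "fst (M (Suc n)) = fst p" "fst (snd (snd (M (Suc n)))) = snd p"
      using p by (auto simp: fst box_def)
    moreover have "mat_mod m (M (Suc n)) = M n"
      using M(1) SZ by (auto simp: Zl_mat_iff_Suc m_def)
    ultimately have "z = (M n, fst p div m, snd p div m)"
      by (simp add: M(2) f_def)
    moreover have "(fst p div m, snd p div m) \<in> box (int l)"
      using p(1) dv[of "fst p"] dv[of "snd p"] by (auto simp: box_def)
    ultimately show "z \<in> level n S \<times> box (int l)" using M(1) by simp
  qed
  moreover have "finite (level n S \<times> box (int l))" using finite_level[OF l_pos SZ] by simp
  ultimately have "card (level (Suc n) S) \<le> card (level n S \<times> box (int l))"
    by (rule card_inj_on_le)
  then show ?thesis by (simp add: card_cartesian_product card_box mult.commute)
qed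

text \<open>From level 1 on, each step multiplies the reductions of the whole Cartan subgroup by
  exactly \<open>l^2\<close> and those of \<open>S\<close> by at most \<open>l^2\<close>.\<close>

lemma level_density_convergent:
  assumes S: "S \<subseteq> cartan0 l t nn"
  shows "convergent (\<lambda>n. real (card (level n S)) / real (card (level n (cartan0 l t nn))))"
    (is "convergent ?r")
proof -
  have "?r (Suc (Suc n)) \<le> ?r (Suc n)" for n
  proof -
    define u where "u = real (card (level (Suc n) (cartan0 l t nn)))"
    have "card (level (Suc (Suc n)) (cartan0 l t nn)) = l ^ 2 * card (level (Suc n) (cartan0 l t nn))"
      using card_level_cartan0_Suc[of "Suc n"] card_level_cartan0_Suc[of n]
      by (simp add: power2_eq_square)
    then have "?r (Suc (Suc n)) = real (card (level (Suc (Suc n)) S)) / (real l ^ 2 * u)"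
      by (simp add: u_def)
    also have "\<dots> \<le> (real l ^ 2 * real (card (level (Suc n) S))) / (real l ^ 2 * u)"
    proof (rule divide_right_mono)
      have "real (card (level (Suc (Suc n)) S)) \<le> real (l ^ 2 * card (level (Suc n) S))"
        using card_level_Suc_le[OF S, of "Suc n"] by (simp only: of_nat_le_iff)
      then show "real (card (level (Suc (Suc n)) S)) \<le> real l ^ 2 * real (card (level (Suc n) S))" by simp
    qed (simp add: u_def)
    also have "\<dots> = ?r (Suc n)" using l_pos by (simp add: u_def)
    finally show ?thesis .
  qed
  \<comment> \<open>The index is shifted because the exact factor \<open>l^2\<close> is available
    only from level 1 on.\<close>
  then have "decseq (\<lambda>n. ?r (Suc n))" by (intro decseq_SucI)
  moreover have "\<forall>n. 0 \<le> ?r (Suc n)" by simp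
  ultimately obtain L where "(\<lambda>n. ?r (Suc n)) \<longlonglongrightarrow> L"
    by (rule decseq_convergent)
  then have "convergent (\<lambda>n. ?r (Suc n))" by (rule convergentI)
  then show ?thesis by (simp only: convergent_Suc_iff[of ?r])
qed

text \<open>The kernel criterion for the conjugate is expressed through \<open>X\<close>, since
  \<open>det (M - I)\<close> agrees with \<open>det (X - I)\<close> modulo
  \<open>l^(j+1)\<close>.\<close>

lemma twisted_conj_ker_iff:
  assumes g: "g \<in> GL2 l" and X: "X \<in> twisted l t nn"
  shows "tors_group (kerMI l (lmat_conj l g X)) \<cong> integer_mod_group (l ^ i) \<times>\<times> integer_mod_group (l ^ (i + j))
    \<longleftrightarrow> i = 0 \<and> int l ^ j dvd det_minus_one (X (Suc j)) \<and> \<not> int l ^ Suc j dvd det_minus_one (X (Suc j))"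
proof -
  define M where "M = lmat_conj l g X"
  have XG: "X \<in> GL2 l" using X twisted_GL2 by blast
  have MZ: "M \<in> Zl_mat l" unfolding M_def using lmat_conj_GL2[OF l g XG] by (rule GL2_Zl)
  obtain a b c d where M: "M = (\<lambda>n. (a n, b n, c n, d n))" by (rule lmat_cases)
  have conj: "mat_mod (int l ^ n) (mat_mul (M n) (g n)) = mat_mod (int l ^ n) (mat_mul (g n) (X n))" for n
    using fun_cong[OF lmat_conj_mult[OF l g XG], of n] by (simp add: lmat_mul_def M_def)
  have "\<not> (int l dvd a 1 - 1 \<and> int l dvd b 1 \<and> int l dvd c 1 \<and> int l dvd d 1 - 1)"
  proof
    assume h: "int l dvd a 1 - 1 \<and> int l dvd b 1 \<and> int l dvd c 1 \<and> int l dvd d 1 - 1"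
    obtain x y where xy: "X 1 = mat_mod (int l ^ 1) (twisted_mat (t 1) (nn 1) (x, y))"
      using X unfolding twisted_def by blast
    obtain p q r s where G: "g 1 = (p,q,r,s)" by (metis prod_cases4)
    have "mat_mod (int l) (M 1) = mat_mod (int l) (1,0,0,1)"
      using h unfolding M mat_mod_eq_iff by (simp add: cong_iff_dvd_diff)
    then have "mat_mod (int l) (mat_mul (M 1) (p,q,r,s)) = mat_mod (int l) (mat_mul (1,0,0,1) (p,q,r,s))"
      by (metis mat_mod_mult_left)
    moreover have "mat_mod (int l) (mat_mul (M 1) (p,q,r,s))
        = mat_mod (int l) (mat_mul (p,q,r,s) (twisted_mat (t 1) (nn 1) (x, y)))"
      using conj[of 1] unfolding xy G power_one_right mat_mod_mult_right .
    ultimately have "mat_mod (int l) (p,q,r,s) = mat_mod (int l) (mat_mul (p,q,r,s) (twisted_mat (t 1) (nn 1) (x, y)))"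
      by (simp only: mat_mul_one)
    then have e: "mat_mod (int l) (p,q,r,s)
        = mat_mod (int l) (mat_mul (p,q,r,s) (x, t 1 * x + nn 1 * y, y, - x))"
      unfolding twisted_mat_def split_conv .
    have "coprime (p * s - q * r) (int l)"
      using GL2_det_coprime[OF l g, of 1] unfolding G by simp
    note h' = conj_identity[OF this e]
    \<comment> \<open>If \<open>x\<close> and \<open>-x\<close> are both 1 modulo \<open>l\<close>,
      then \<open>l\<close> divides 2; the off-diagonal entries make \<open>l\<close> divide
      \<open>t\<close>, and hence the discriminant, a contradiction.\<close>
    have "int l dvd - ((- x - 1) + (x - 1))" using h' by (intro dvd_minus_iff[THEN iffD2] dvd_add)
    then have two: "int l dvd 2" by simp
    have "int l dvd (t 1 * x + nn 1 * y) - nn 1 * y - t 1 * (x - 1)"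
      by (intro dvd_diff dvd_mult h'(1-3))
    moreover have "(t 1 * x + nn 1 * y) - nn 1 * y - t 1 * (x - 1) = t 1" by (simp add: algebra_simps)
    ultimately have "int l dvd t 1" by simp
    then have "int l dvd t 1 * t 1 - 2 * (2 * nn 1)"
      using \<open>int l dvd t 1\<close> two by (intro dvd_diff dvd_mult2)
    then show False using D by (simp add: power2_eq_square)
  qed
  from kerMI_iso_iff[OF l M MZ this]
  have "tors_group (kerMI l M) \<cong> integer_mod_group (l ^ i) \<times>\<times> integer_mod_group (l ^ (i + j)) \<longleftrightarrow>
    i = 0 \<and> int l ^ j dvd det_minus_one (M (Suc j)) \<and> \<not> int l ^ Suc j dvd det_minus_one (M (Suc j))"
    by (simp add: M)
  moreover have c: "[det_minus_one (M (Suc j)) = det_minus_one (X (Suc j))] (mod int l ^ Suc j)"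
    by (rule det_minus_one_conj[OF GL2_det_coprime[OF l g] conj])
  have c': "[det_minus_one (M (Suc j)) = det_minus_one (X (Suc j))] (mod int l ^ j)"
    by (rule cong_dvd_modulus[OF c]) simp
  ultimately show ?thesis
    using cong_dvd_iff[OF c] cong_dvd_iff[OF c'] unfolding M_def by blast
qed

text \<open>An equality at every level above \<open>b\<close> and not merely a limit: such a level
  determines the norm modulo \<open>l^(b+1)\<close>.\<close>

lemma twisted_density:
  assumes g: "g \<in> GL2 l" and n: "n > b"
  shows "real (card (level n {X \<in> twisted l t nn. tors_group (kerMI l (lmat_conj l g X))
        \<cong> integer_mod_group (l ^ a) \<times>\<times> integer_mod_group (l ^ (a + b))}))
      / real (card (level n (cartan0 l t nn))) = mu_star l a b"
proof (cases "a = 0")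
  case False
  then have "\<not> tors_group (kerMI l (lmat_conj l g X)) \<cong> integer_mod_group (l ^ a) \<times>\<times> integer_mod_group (l ^ (a + b))"
    if "X \<in> twisted l t nn" for X
    using twisted_conj_ker_iff[OF g that, of a b] by simp
  then have e: "{X \<in> twisted l t nn. tors_group (kerMI l (lmat_conj l g X))
        \<cong> integer_mod_group (l ^ a) \<times>\<times> integer_mod_group (l ^ (a + b))} = {}"
    by simp
  show ?thesis unfolding e using False by (simp add: mu_star_def)
next
  case True
  have n1: "n \<ge> 1" using n by simp
  define Q where "Q = (\<lambda>p. int l ^ b dvd norm_at n p - 1 \<and> \<not> int l ^ Suc b dvd norm_at n p - 1)"
  have key: "tors_group (kerMI l (lmat_conj l g X)) \<cong> integer_mod_group (l ^ a) \<times>\<times> integer_mod_group (l ^ (a + b))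
      \<longleftrightarrow> Q (x n mod int l ^ n, y n mod int l ^ n)"
    if X: "X \<in> twisted l t nn" and xy: "coherent l x" "coherent l y"
      and Xk: "\<And>k. X k = mat_mod (int l ^ k) (twisted_mat (t k) (nn k) (x k, y k))" for X x y
  proof -
    let ?q = "qform (t n) (nn n) (x n mod int l ^ n) (y n mod int l ^ n)"
    let ?q' = "qform (t (Suc b)) (nn (Suc b)) (x (Suc b)) (y (Suc b))"
    have "[det_minus_one (X (Suc b)) = 1 - ?q'] (mod int l ^ Suc b)"
      unfolding Xk[of "Suc b"] det_minus_one_twisted[symmetric] by (rule det_minus_one_mod)
    also have "[1 - ?q' = 1 - ?q] (mod int l ^ Suc b)"
      using n by (intro cong_diff cong_refl cong_sym[OF norm_at_cong[OF xy]]) simp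
    finally have c: "[det_minus_one (X (Suc b)) = 1 - ?q] (mod int l ^ Suc b)" .
    have c': "[det_minus_one (X (Suc b)) = 1 - ?q] (mod int l ^ b)"
      by (rule cong_dvd_modulus[OF c]) simp
    have "int l ^ b dvd det_minus_one (X (Suc b)) \<longleftrightarrow> int l ^ b dvd ?q - 1"
      "int l ^ Suc b dvd det_minus_one (X (Suc b)) \<longleftrightarrow> int l ^ Suc b dvd ?q - 1"
      using cong_dvd_iff[OF c] cong_dvd_iff[OF c'] dvd_diff_commute by blast+
    then show ?thesis
      using twisted_conj_ker_iff[OF g X, of a b] True by (simp only: Q_def fst_conv snd_conv simp_thms)
  qed
  have "card (level n {X \<in> twisted l t nn. tors_group (kerMI l (lmat_conj l g X))
        \<cong> integer_mod_group (l ^ a) \<times>\<times> integer_mod_group (l ^ (a + b))})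
      = card {p \<in> unit_pairs l (t n) (nn n) n. Q p}"
    by (rule card_level_twisted[OF n1, where Q = Q]) (rule key)
  also have "{p \<in> unit_pairs l (t n) (nn n) n. Q p} = {(x,y) \<in> unit_pairs l (t n) (nn n) n.
      int l ^ b dvd qform (t n) (nn n) x y - 1 \<and> \<not> int l ^ Suc b dvd qform (t n) (nn n) x y - 1}"
    by (auto simp: Q_def)
  finally show ?thesis
    using card_norm_exact[OF l disc_coprime(1)[OF l t nn D n1] n] True card_level_cartan0[OF n1] by simp
qed

end

section \<open>Passage to the limit in the normalizer\<close>

theorem theorem4:
  fixes l :: nat and t nn :: "nat \<Rightarrow> int" and g :: lmat and C N :: "lmat set" and a b :: nat
  assumes "prime l"
    and "t \<in> Zl l" and "nn \<in> Zl l"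
    and "\<not> int l dvd (t 1 ^ 2 - 4 * nn 1)"
    and "g \<in> GL2 l"
    and "C = conj_set l g (cartan0 l t nn)"
    and "N = normalizer l C"
  shows "haar N (Mab l a b N) = 1/2 * haar C (Mab l a b C) + 1/2 * mu_star l a b"
proof -
  note l = assms(1) and D = assms(4) and g = assms(5)
  have t: "coherent l t" and nn: "coherent l nn" using assms(2,3) Zl_coherent by auto
  let ?C = "cartan0 l t nn" and ?T = "twisted l t nn"
  define P where "P = (\<lambda>X. tors_group (kerMI l (lmat_conj l g X))
      \<cong> integer_mod_group (l ^ a) \<times>\<times> integer_mod_group (l ^ (a + b)))"
  have CT: "?C \<union> ?T \<subseteq> GL2 l" using cartan0_GL2 twisted_GL2 by blast
  have C: "C = lmat_conj l g ` ?C" unfolding assms(6) by (rule conj_set_eq[OF l g cartan0_GL2])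
  have "N = conj_set l g (normalizer l ?C)"
    unfolding assms(6,7) by (rule normalizer_conj[OF l g cartan0_GL2])
  also have "\<dots> = lmat_conj l g ` (?C \<union> ?T)"
    unfolding normalizer_cartan0[OF l t nn D] by (rule conj_set_eq[OF l g CT])
  finally have N: "N = lmat_conj l g ` (?C \<union> ?T)" .
  have CM: "C \<inter> Mab l a b C = lmat_conj l g ` {X \<in> ?C. P X}"
    unfolding Mab_def C P_def by blast
  have NM: "N \<inter> Mab l a b N = lmat_conj l g ` ({X \<in> ?C. P X} \<union> {X \<in> ?T. P X})"
    unfolding Mab_def N P_def by blast
  define u v w where "u = (\<lambda>n. real (card (level n ?C)))" and "v = (\<lambda>n. real (card (level n {X \<in> ?C. P X})))"
    and "w = (\<lambda>n. real (card (level n {X \<in> ?T. P X})))"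
  have fin: "finite (level n S)" if "S \<subseteq> GL2 l" for n S
    using that GL2_Zl by (intro finite_level[OF prime_gt_0_nat[OF l]]) blast
  have lev: "card (level n (lmat_conj l g ` (S \<union> R))) = card (level n S) + card (level n R)"
    if "n \<ge> 1" "S \<subseteq> ?C" "R \<subseteq> ?T" for n S R
  proof -
    have "S \<subseteq> GL2 l" "R \<subseteq> GL2 l" using that CT by blast+
    then have "card (level n (lmat_conj l g ` (S \<union> R))) = card (level n S \<union> level n R)"
      using card_level_lmat_conj[OF l g, of "S \<union> R" n] by (simp add: image_Un)
    also have "\<dots> = card (level n S) + card (level n R)"
    proof (rule card_Un_disjoint[OF fin[OF \<open>S \<subseteq> GL2 l\<close>] fin[OF \<open>R \<subseteq> GL2 l\<close>]])
      have "level n S \<subseteq> level n ?C" "level n R \<subseteq> level n ?T"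
        by (rule image_mono[OF that(2)], rule image_mono[OF that(3)])
      then show "level n S \<inter> level n R = {}" using level_disjoint[OF l t nn D that(1)] by blast
    qed
    finally show ?thesis .
  qed
  \<comment> \<open>\<open>haar\<close> is a \<open>lim\<close>, which is informative only once
    convergence is known; with it the limit over the normalizer splits into two halves.\<close>
  have "convergent (\<lambda>n. v n / u n)"
    unfolding u_def v_def by (rule level_density_convergent[OF l t nn D]) blast
  then obtain L where L: "(\<lambda>n. v n / u n) \<longlonglongrightarrow> L" by (auto simp: convergent_def)
  have "{X \<in> ?C. P X} \<subseteq> GL2 l" using cartan0_GL2 by blast
  then have hC: "haar C (Mab l a b C) = L"
    unfolding haar_def CM unfolding C card_level_lmat_conj[OF l g cartan0_GL2] card_level_lmat_conj[OF l g]
    using limI[OF L] by (simp add: u_def v_def card_level_lmat_conj[OF l g])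
  \<comment> \<open>The bound \<open>n > b\<close> makes the twisted proportion exact and also gives
    \<open>n \<ge> 1\<close>, where the two halves have disjoint reductions of equal number.\<close>
  have "eventually (\<lambda>n. 1/2 * (v n / u n) + 1/2 * mu_star l a b
      = real (card (level n (N \<inter> Mab l a b N))) / real (card (level n N))) sequentially"
    using eventually_gt_at_top[of b]
  proof eventually_elim
    case (elim n)
    then have n: "n \<ge> 1" by simp
    have "real (card (level n (N \<inter> Mab l a b N))) = v n + w n"
      unfolding NM v_def w_def by (subst lev[OF n]) auto
    moreover have "real (card (level n N)) = 2 * u n"
      unfolding N u_def by (subst lev[OF n]) (auto simp: card_level_twisted_UNIV[OF l t nn D n])
    moreover have "w n / u n = mu_star l a b"
      unfolding w_def u_def P_def by (rule twisted_density[OF l t nn D g elim])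
    ultimately show ?case by (simp add: add_divide_distrib)
  qed
  moreover have "(\<lambda>n. 1/2 * (v n / u n) + 1/2 * mu_star l a b) \<longlonglongrightarrow> 1/2 * L + 1/2 * mu_star l a b"
    by (intro tendsto_intros L)
  ultimately have "(\<lambda>n. real (card (level n (N \<inter> Mab l a b N))) / real (card (level n N)))
      \<longlonglongrightarrow> 1/2 * L + 1/2 * mu_star l a b"
    by (rule Lim_transform_eventually[rotated])
  then show ?thesis unfolding haar_def[of N] hC by (rule limI)
qed

end
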